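(* For every positive integer $n$, (1) $$\sum_{\sigma\in S_n}q^{\ell_S(\sigma)}t^{\mathrm{del}_S(\sigma)}=\sum_{\sigma\in S_n}q^{\mathrm{rmaj}_{S_n}(\sigma)}t^{\mathrm{del}_S(\sigma)}=(1+qt)(1+q+q^2t)\cdots(1+q+\dots+q^{n-2}+q^{n-1}t),$$ (2) $$\sum_{w\in A_{n+1}}q^{\ell_A(w)}t^{\mathrm{del}_A(w)}=\sum_{w\in A_{n+1}}q^{\mathrm{rmaj}_{A_{n+1}}(w)}t^{\mathrm{del}_A(w)}=(1+2qt)(1+q+2q^2t)\cdots(1+q+\dots+q^{n-2}+2q^{n-1}t).$$
   Context: Permutations are in one-line notation and multiplied as functions, $(\sigma\tau)(k)=\sigma(\tau(k))$; $s_i=(i,i+1)$. $\mathrm{Des}_S(\pi)=\{i\in[n-1]:\pi(i)>\pi(i+1)\}$, $\mathrm{rmaj}_{S_n}(\pi)=\sum_{i\in\mathrm{Des}_S(\pi)}(n-i)$, $\ell_S(\pi)$ = number of inversions. For $1\le j\le n-1$ let $R^S_j=\{1,s_j,s_js_{j-1},\dots,s_j\cdots s_1\}$; every $w\in S_n$ factors uniquely as $w_1\cdots w_{n-1}$ with $w_j\in R^S_j$, and $\mathrm{del}_S(w)$ is the number of $j$ with $w_j=s_j\cdots s_1$. In $S_{n+1}$, $a_i=s_1s_{i+1}$ ($1\le i\le n-1$); $R^A_j=\{1,a_j,a_ja_{j-1},\dots,a_j\cdots a_2,a_j\cdots a_2a_1,a_j\cdots a_2a_1^{-1}\}$ (words;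 $R^A_1=\{1,a_1,a_1^{-1}\}$). Every $v\in A_{n+1}$ factors uniquely as $v_1\cdots v_{n-1}$ with $v_j\in R^A_j$; $\ell_A(v)$ = total number of letters $a_i^{\pm1}$, $\mathrm{del}_A(v)$ = number of letters $a_1^{\pm1}$. $\mathrm{Des}_A(\sigma)=\{1\le i\le n-1:\ell_A(\sigma)\ge\ell_A(\sigma a_i)\}$, $\mathrm{rmaj}_{A_{n+1}}(\sigma)=\sum_{i\in\mathrm{Des}_A(\sigma)}(n-i)$. *)

theory Defs
  imports "HOL-Algebra.Sym_Groups"
begin

text \<open>
  Permutations are functions on \<^typ>\<open>nat\<close> fixing everything outside \<open>{1..n}\<close>; the product is
  composition. Since \<open>\<circ>\<close> composes as functions, a word \<open>[x\<^sub>1, \<dots>, x\<^sub>k]\<close> evaluates to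
  \<open>x\<^sub>1 \<circ> \<dots> \<circ> x\<^sub>k\<close>.
\<close>

definition word_prod :: "('l \<Rightarrow> nat \<Rightarrow> nat) \<Rightarrow> 'l list \<Rightarrow> nat \<Rightarrow> nat" where
  "word_prod gen w = foldr (\<lambda>x p. gen x \<circ> p) w id"

text \<open>
  \<open>is_factorization gen R n p ws\<close>: \<open>p = w\<^sub>1 \<cdots> w\<^bsub>n-1\<^esub>\<close> with \<open>w\<^sub>j \<in> R j\<close>; the factor \<open>w\<^sub>j\<close> is stored,
  as a word, at position \<open>j - 1\<close> of \<open>ws\<close>.
\<close>

definition is_factorization ::
    "('l \<Rightarrow> nat \<Rightarrow> nat) \<Rightarrow> (nat \<Rightarrow> 'l list set) \<Rightarrow> nat \<Rightarrow> (nat \<Rightarrow> nat) \<Rightarrow> 'l list list \<Rightarrow> bool" where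
  "is_factorization gen R n p ws \<longleftrightarrow>
     length ws = n - 1 \<and> (\<forall>j\<in>{1..n - 1}. ws ! (j - 1) \<in> R j) \<and> word_prod gen (concat ws) = p"


definition s_gen :: "nat \<Rightarrow> nat \<Rightarrow> nat" where
  "s_gen i = transpose i (i + 1)"

text \<open>The word \<open>rev [k..<Suc j]\<close> is \<open>s\<^sub>j s\<^bsub>j-1\<^esub> \<cdots> s\<^sub>k\<close>; it is empty for \<open>k = j + 1\<close>.\<close>

definition R_S :: "nat \<Rightarrow> nat list set" where
  "R_S j = {rev [k..<Suc j] | k. 1 \<le> k \<and> k \<le> j + 1}"

definition factors_S :: "nat \<Rightarrow> (nat \<Rightarrow> nat) \<Rightarrow> nat list list" where
  "factors_S n p = (THE ws. is_factorization s_gen R_S n p ws)"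

definition del_S :: "nat \<Rightarrow> (nat \<Rightarrow> nat) \<Rightarrow> nat" where
  "del_S n p = card {j \<in> {1..n - 1}. factors_S n p ! (j - 1) = rev [1..<Suc j]}"

definition len_S :: "nat \<Rightarrow> (nat \<Rightarrow> nat) \<Rightarrow> nat" where
  "len_S n p = card {(i, j). 1 \<le> i \<and> i < j \<and> j \<le> n \<and> p i > p j}"

definition Des_S :: "nat \<Rightarrow> (nat \<Rightarrow> nat) \<Rightarrow> nat set" where
  "Des_S n p = {i \<in> {1..n - 1}. p i > p (i + 1)}"

definition rmaj_S :: "nat \<Rightarrow> (nat \<Rightarrow> nat) \<Rightarrow> nat" where
  "rmaj_S n p = (\<Sum>i\<in>Des_S n p. n - i)"


definition a_gen :: "nat \<Rightarrow> nat \<Rightarrow> nat" where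
  "a_gen i = s_gen 1 \<circ> s_gen (i + 1)"

text \<open>The letter \<open>(i, True)\<close> stands for \<open>a\<^sub>i\<close>, the letter \<open>(i, False)\<close> for its inverse.\<close>

definition a_letter :: "nat \<times> bool \<Rightarrow> nat \<Rightarrow> nat" where
  "a_letter x = (if snd x then a_gen (fst x) else inv_into UNIV (a_gen (fst x)))"

definition R_A :: "nat \<Rightarrow> (nat \<times> bool) list set" where
  "R_A j = {map (\<lambda>i. (i, True)) (rev [k..<Suc j]) | k. 1 \<le> k \<and> k \<le> j + 1}
           \<union> {map (\<lambda>i. (i, True)) (rev [2..<Suc j]) @ [(1, False)]}"

text \<open>
  In the statistics for the alternating group below, the index \<open>n\<close> belongs to the group on
  \<open>{1..n + 1}\<close>, whose elements have \<open>n - 1\<close> factors.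
\<close>

definition factors_A :: "nat \<Rightarrow> (nat \<Rightarrow> nat) \<Rightarrow> (nat \<times> bool) list list" where
  "factors_A n p = (THE ws. is_factorization a_letter R_A n p ws)"

definition len_A :: "nat \<Rightarrow> (nat \<Rightarrow> nat) \<Rightarrow> nat" where
  "len_A n p = length (concat (factors_A n p))"

definition del_A :: "nat \<Rightarrow> (nat \<Rightarrow> nat) \<Rightarrow> nat" where
  "del_A n p = length (filter (\<lambda>x. fst x = 1) (concat (factors_A n p)))"

definition Des_A :: "nat \<Rightarrow> (nat \<Rightarrow> nat) \<Rightarrow> nat set" where
  "Des_A n p = {i \<in> {1..n - 1}. len_A n p \<ge> len_A n (p \<circ> a_gen i)}"

definition rmaj_A :: "nat \<Rightarrow> (nat \<Rightarrow> nat) \<Rightarrow> nat" where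
  "rmaj_A n p = (\<Sum>i\<in>Des_A n p. n - i)"

end

theory Submission
  imports Defs
begin

text \<open>
  The last factor of a permutation of \<open>{1..n + 1}\<close> records where the largest entry \<open>n + 1\<close> has been
  inserted into the one-line notation of a permutation of \<open>{1..n}\<close>. Inserting it after \<open>j\<close> entries
  creates \<open>n - j\<close> inversions. The reverse major index grows by an amount that depends on the descent
  set, but over all \<open>j\<close> these increments form a permutation of \<open>0, \<dots>, n\<close> in which \<open>j = 0\<close>, the only
  position counted by \<open>del\<^sub>S\<close>, always gets \<open>n\<close>. Either way each step multiplies the sum by
  \<open>1 + q + \<dots> + q\<^bsup>n-1\<^esup> + q\<^bsup>n\<^esup> t\<close>.

  For the alternating group on \<open>{1..n + 2}\<close>, the last factor inserts \<open>n + 2\<close> after possibly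
  exchanging the first two entries to correct the parity. The number \<open>\<ell>\<^sub>A\<close> is a maximum minus a
  statistic that ignores the order of the first two entries, which gives
  \<open>i \<in> Des\<^sub>A(\<sigma>)\<close> iff \<open>\<sigma>(i+1) > \<sigma>(i+2)\<close> or \<open>\<sigma>(i+2)\<close> is smaller than all of \<open>\<sigma>(1), \<dots>, \<sigma>(i)\<close>.
  This set evolves under insertion exactly as the descent set does for the symmetric group, except
  that the two leftmost positions both act as \<open>j = 0\<close>; hence the factor 2.
\<close>

section \<open>Factorizations along a chain of transversals\<close>

lemma word_prod_Nil [simp]: "word_prod gen [] = id"
  by (simp add: word_prod_def)

lemma word_prod_Cons [simp]: "word_prod gen (x # w) = gen x \<circ> word_prod gen w"
  by (simp add: word_prod_def)

lemma word_prod_append [simp]: "word_prod gen (v @ w) = word_prod gen v \<circ> word_prod gen w"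
  by (induction v) (auto simp: comp_assoc)

text \<open>The words of \<open>R n\<close> evaluate to representatives of the cosets of
  \<open>G n\<close> in \<open>G (Suc n)\<close>. The instances are the chains of the S_n and of the
  A_{n+1}; only the unique decomposition of a single step is assumed.\<close>

locale transversal_chain =
  fixes gen :: "'l \<Rightarrow> nat \<Rightarrow> nat" and R :: "nat \<Rightarrow> 'l list set" and G :: "nat \<Rightarrow> (nat \<Rightarrow> nat) set"
  assumes G_1: "G (Suc 0) = {id}"
    and bij_step:
      "n \<ge> 1 \<Longrightarrow> bij_betw (\<lambda>(p, w). p \<circ> word_prod gen w) (G n \<times> R n) (G (Suc n))"
begin

definition factors :: "nat \<Rightarrow> (nat \<Rightarrow> nat) \<Rightarrow> 'l list list" where
  "factors n p = (THE ws. is_factorization gen R n p ws)"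

lemma step_in: "\<lbrakk>n \<ge> 1; p \<in> G n; w \<in> R n\<rbrakk> \<Longrightarrow> p \<circ> word_prod gen w \<in> G (Suc n)"
  using bij_betwE[OF bij_step] by fastforce

lemma step_inj:
  "\<lbrakk>n \<ge> 1; p \<in> G n; w \<in> R n; p' \<in> G n; w' \<in> R n; p \<circ> word_prod gen w = p' \<circ> word_prod gen w'\<rbrakk>
    \<Longrightarrow> p = p' \<and> w = w'"
  using inj_onD[OF bij_betw_imp_inj_on[OF bij_step], of n "(p, w)" "(p', w')"] by auto

lemma step_surj:
  assumes "n \<ge> 1" "p \<in> G (Suc n)"
  obtains p' w where "p' \<in> G n" "w \<in> R n" "p = p' \<circ> word_prod gen w"
  using bij_betw_imp_surj_on[OF bij_step[OF assms(1)]] assms(2) by (fastforce simp: image_iff)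

lemma is_factorization_snoc:
  assumes "is_factorization gen R n p ws" "w \<in> R n" "n \<ge> 1"
  shows "is_factorization gen R (Suc n) (p \<circ> word_prod gen w) (ws @ [w])"
proof -
  have len: "length ws = n - 1" and R: "\<forall>j\<in>{1..n - 1}. ws ! (j - 1) \<in> R j"
    using assms by (auto simp: is_factorization_def)
  have "(ws @ [w]) ! (j - 1) \<in> R j" if "j \<in> {1..n}" for j
  proof (cases "j = n")
    case True
    then show ?thesis using len assms by (metis nth_append_length)
  next
    case False
    then have "j \<in> {1..n - 1}" "j - 1 < length ws" using that len by auto
    then show ?thesis using R by (simp add: nth_append)
  qed
  then show ?thesis using assms by (simp add: is_factorization_def)
qed

lemma is_factorization_SucD:
  assumes "is_factorization gen R (Suc n) p ws" "n \<ge> 1"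
  obtains ws' w where "ws = ws' @ [w]" "w \<in> R n"
    "is_factorization gen R n (word_prod gen (concat ws')) ws'" "p = word_prod gen (concat ws') \<circ> word_prod gen w"
proof -
  from assms have "ws \<noteq> []" by (auto simp: is_factorization_def)
  then obtain ws' w where ws: "ws = ws' @ [w]" by (metis rev_exhaust)
  have len: "length ws' = n - 1" using assms ws by (auto simp: is_factorization_def)
  have R: "ws ! (j - 1) \<in> R j" if "j \<in> {1..n}" for j
    using assms(1) that unfolding is_factorization_def by simp
  have "w \<in> R n" using R[of n] assms(2) ws len by (metis atLeastAtMost_iff le_refl nth_append_length)
  moreover have "ws' ! (j - 1) \<in> R j" if "j \<in> {1..n - 1}" for j
  proof -
    have "j - 1 < length ws'" "j \<in> {1..n}" using that len by auto
    then show ?thesis using R[of j] ws by (simp add: nth_append)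
  qed
  ultimately show ?thesis using that[of ws' w] ws len assms(1)
    by (auto simp: is_factorization_def)
qed

text \<open>Uniqueness below rests on this: \<open>step_inj\<close> applies to a prefix of a
  factorization only once its product is known to lie in \<open>G n\<close>.\<close>

lemma word_prod_in:
  "\<lbrakk>n \<ge> 1; is_factorization gen R n p ws\<rbrakk> \<Longrightarrow> p \<in> G n"
proof (induction n arbitrary: p ws rule: nat_induct_at_least)
  case base
  then show ?case by (auto simp: is_factorization_def G_1 id_def)
next
  case (Suc n)
  from Suc.prems Suc.hyps obtain ws' w where "w \<in> R n"
    "is_factorization gen R n (word_prod gen (concat ws')) ws'"
    "p = word_prod gen (concat ws') \<circ> word_prod gen w"
    by (rule is_factorization_SucD)
  then show ?case using step_in Suc by blast
qed

text \<open>Peel off the last factor: surjectivity of the step gives existence, injectivity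
  determines the last factor and the product of the others.\<close>

lemma ex1_factorization:
  "\<lbrakk>n \<ge> 1; p \<in> G n\<rbrakk> \<Longrightarrow> \<exists>!ws. is_factorization gen R n p ws"
proof (induction n arbitrary: p rule: nat_induct_at_least)
  case base
  then show ?case by (auto simp: is_factorization_def G_1 id_def)
next
  case (Suc n)
  obtain p' w where p': "p' \<in> G n" "w \<in> R n" "p = p' \<circ> word_prod gen w"
    using step_surj Suc.hyps Suc.prems by blast
  obtain ws where ws: "is_factorization gen R n p' ws" "\<And>us. is_factorization gen R n p' us \<Longrightarrow> us = ws"
    using Suc.IH[OF p'(1)] by blast
  show ?case
  proof (rule ex1I)
    show "is_factorization gen R (Suc n) p (ws @ [w])"
      using is_factorization_snoc ws p' Suc.hyps by blast
  next
    fix us assume "is_factorization gen R (Suc n) p us"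
    then obtain us' u where u: "us = us' @ [u]" "u \<in> R n"
      "is_factorization gen R n (word_prod gen (concat us')) us'"
      "p = word_prod gen (concat us') \<circ> word_prod gen u"
      using Suc.hyps by (rule is_factorization_SucD)
    have "p' = word_prod gen (concat us') \<and> w = u"
      using step_inj[OF Suc.hyps p'(1,2) word_prod_in[OF Suc.hyps u(3)] u(2)] p'(3) u(4) by simp
    then show "us = ws @ [w]" using u ws(2) by simp
  qed
qed

lemma factors_Suc_0: "factors (Suc 0) id = []"
  unfolding factors_def
  by (rule the1_equality[OF ex1_factorization]) (auto simp: G_1 is_factorization_def)

lemma is_factorization_factors:
  "\<lbrakk>n \<ge> 1; p \<in> G n\<rbrakk> \<Longrightarrow> is_factorization gen R n p (factors n p)"
  unfolding factors_def by (rule theI'[OF ex1_factorization])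

lemma length_factors: "\<lbrakk>n \<ge> 1; p \<in> G n\<rbrakk> \<Longrightarrow> length (factors n p) = n - 1"
  using is_factorization_factors by (auto simp: is_factorization_def)

text \<open>Replaces the definite description by a recursion, from which all statistics that read
  off the factors are computed.\<close>

lemma factors_Suc:
  assumes "n \<ge> 1" "p \<in> G n" "w \<in> R n"
  shows "factors (Suc n) (p \<circ> word_prod gen w) = factors n p @ [w]"
  unfolding factors_def[of "Suc n"]
  using assms ex1_factorization[of "Suc n"] step_in is_factorization_snoc is_factorization_factors
  by (intro the1_equality) auto

text \<open>The step bijection turns the sum over \<open>G (Suc n)\<close> into a double sum. As the
  inner sum is \<open>F n p\<close> times a factor that does not depend on \<open>p\<close>, the
  product grows by one factor at each step.\<close>

lemma sum_eq_prod:
  fixes F :: "nat \<Rightarrow> (nat \<Rightarrow> nat) \<Rightarrow> 'b :: comm_semiring_1"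
  assumes "F (Suc 0) id = 1"
    and step: "\<And>n p. \<lbrakk>n \<ge> 1; p \<in> G n\<rbrakk> \<Longrightarrow>
      (\<Sum>w\<in>R n. F (Suc n) (p \<circ> word_prod gen w)) = F n p * c n"
    and "n \<ge> 1"
  shows "(\<Sum>p\<in>G n. F n p) = (\<Prod>j = 1..n - 1. c j)"
  using \<open>n \<ge> 1\<close>
proof (induction n rule: nat_induct_at_least)
  case base
  then show ?case using assms(1) by (simp add: G_1 id_def)
next
  case (Suc n)
  have "(\<Sum>p\<in>G (Suc n). F (Suc n) p) = (\<Sum>(p, w)\<in>G n \<times> R n. F (Suc n) (p \<circ> word_prod gen w))"
    by (subst sum.reindex_bij_betw[OF bij_step[OF Suc.hyps], symmetric]) (simp add: case_prod_beta)
  also have "\<dots> = (\<Sum>p\<in>G n. F n p * c n)"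
    by (subst sum.cartesian_product[symmetric]) (intro sum.cong refl step Suc.hyps)
  also have "\<dots> = (\<Prod>j = 1..n - 1. c j) * c n"
    by (simp add: Suc.IH flip: sum_distrib_right)
  also have "\<dots> = (\<Prod>j = 1..Suc n - 1. c j)"
    using Suc.hyps by (cases n) simp_all
  finally show ?case .
qed

end

section \<open>Inserting a new largest entry\<close>

text \<open>\<open>D\<close> stands for the descent set of a sequence of \<open>n\<close> entries,
  and a new maximum is inserted after the first \<open>j\<close>. A descent at \<open>j\<close> is
  broken, later ones shift, and the maximum starts a descent unless it comes last. Keeping
  \<open>D\<close> abstract lets the same rule serve both groups.\<close>

definition ins_des :: "nat \<Rightarrow> nat \<Rightarrow> nat set \<Rightarrow> nat set" where
  "ins_des n j D = {i \<in> D. i < j} \<union> Suc ` {i \<in> D. i > j} \<union> (if j < n then {Suc j} else {})"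

lemma mem_ins_des:
  "i \<in> ins_des n j D \<longleftrightarrow> i \<in> D \<and> i < j \<or> Suc j < i \<and> i - 1 \<in> D \<or> i = Suc j \<and> j < n"
  by (cases i) (auto simp: ins_des_def)

definition ins_incr :: "nat \<Rightarrow> nat set \<Rightarrow> nat \<Rightarrow> nat" where
  "ins_incr n D j = card {i \<in> D. i < j} + (if j \<in> D then 0 else n - j)"

text \<open>Each descent left of the slot gains weight 1 because \<open>n\<close> grows, while the
  shifted ones keep theirs. The new descent weighs \<open>n - j\<close>, which is exactly the weight
  lost if \<open>j\<close> itself was a descent.\<close>

lemma sum_ins_des:
  assumes D: "D \<subseteq> {1..n - 1}" and j: "j \<le> n"
  shows "(\<Sum>i\<in>ins_des n j D. Suc n - i) = (\<Sum>i\<in>D. n - i) + ins_incr n D j"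
proof -
  have fin: "finite D" using D finite_subset by blast
  let ?L = "{i \<in> D. i < j}" and ?U = "{i \<in> D. i > j}" and ?J = "if j < n then {Suc j} else {}"
  have "(\<Sum>i\<in>ins_des n j D. Suc n - i)
      = (\<Sum>i\<in>?L. Suc n - i) + (\<Sum>i\<in>Suc ` ?U. Suc n - i) + (\<Sum>i\<in>?J. Suc n - i)"
    unfolding ins_des_def using fin by (subst sum.union_disjoint, auto)+
  also have "(\<Sum>i\<in>?L. Suc n - i) = (\<Sum>i\<in>?L. (n - i) + 1)"
    using j by (intro sum.cong) auto
  also have "\<dots> = (\<Sum>i\<in>?L. n - i) + card ?L"
    by (subst sum.distrib) simp
  also have "(\<Sum>i\<in>Suc ` ?U. Suc n - i) = (\<Sum>i\<in>?U. n - i)"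
    by (subst sum.reindex) auto
  also have "(\<Sum>i\<in>?J. Suc n - i) = n - j"
    using j by auto
  finally have 1: "(\<Sum>i\<in>ins_des n j D. Suc n - i)
      = (\<Sum>i\<in>?L. n - i) + card ?L + (\<Sum>i\<in>?U. n - i) + (n - j)" .
  have "D = ?L \<union> ?U \<union> (D \<inter> {j})" by auto
  then have "(\<Sum>i\<in>D. n - i) = (\<Sum>i\<in>?L \<union> ?U \<union> (D \<inter> {j}). n - i)" by simp
  also have "\<dots> = (\<Sum>i\<in>?L. n - i) + (\<Sum>i\<in>?U. n - i) + (\<Sum>i\<in>D \<inter> {j}. n - i)"
    using fin by (simp add: sum.union_disjoint disjoint_iff)
  also have "(\<Sum>i\<in>D \<inter> {j}. n - i) = (if j \<in> D then n - j else 0)" by auto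
  finally show ?thesis using 1 by (simp add: ins_incr_def)
qed

lemma ins_incr_0: "D \<subseteq> {1..n - 1} \<Longrightarrow> ins_incr n D 0 = n"
  by (force simp: ins_incr_def)

text \<open>
  On \<open>D \<union> {n}\<close> the increment counts up through \<open>0, \<dots>, card D\<close>; on the remaining slots, read from
  right to left, it continues through \<open>card D + 1, \<dots>, n\<close>.
\<close>

lemma bij_betw_ins_incr:
  assumes D: "D \<subseteq> {1..n - 1}"
  shows "bij_betw (ins_incr n D) {..n} {..n}"
proof -
  have fin: "finite D" using D finite_subset by blast
  let ?c = "\<lambda>j. card {i \<in> D. i < j}"
  \<comment> \<open>From \<open>j\<close> to \<open>k\<close> the count \<open>?c\<close> gains the
    number of elements of \<open>D\<close> in \<open>{j..<k}\<close>: at least one if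
    \<open>j\<close> is in \<open>D\<close>, fewer than \<open>k - j\<close> if it is not.\<close>
  have step: "j \<in> D \<Longrightarrow> ?c j < ?c k" "j \<notin> D \<Longrightarrow> ?c k < ?c j + (k - j)"
    if "j < k" for j k
  proof -
    have split: "{i \<in> D. i < k} = {i \<in> D. i < j} \<union> (D \<inter> {j..<k})" using that by auto
    have eq: "?c k = ?c j + card (D \<inter> {j..<k})"
      unfolding split using fin by (intro card_Un_disjoint) auto
    show "?c j < ?c k" if "j \<in> D"
      using eq that \<open>j < k\<close> fin card_gt_0_iff[of "D \<inter> {j..<k}"] by auto
    show "?c k < ?c j + (k - j)" if "j \<notin> D"
    proof -
      have "D \<inter> {j..<k} \<subset> {j..<k}" using that \<open>j < k\<close> by force
      then have "card (D \<inter> {j..<k}) < card {j..<k}" by (intro psubset_card_mono) auto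
      then show ?thesis using eq by simp
    qed
  qed
  \<comment> \<open>The left slot decides: if it lies in \<open>D\<close> its increment is the
    smaller one, otherwise the larger one.\<close>
  have less: "ins_incr n D j \<noteq> ins_incr n D k" if "j < k" "k \<le> n" for j k
  proof (cases "j \<in> D")
    case True
    have "ins_incr n D j = ?c j" "ins_incr n D k \<ge> ?c k" using True by (simp_all add: ins_incr_def)
    then show ?thesis using step(1)[OF that(1) True] by simp
  next
    case False
    have "ins_incr n D j = ?c j + (n - j)" "ins_incr n D k \<le> ?c k + (n - k)"
      using False by (simp_all add: ins_incr_def)
    then show ?thesis using step(2)[OF that(1) False] that by simp
  qed
  have "inj_on (ins_incr n D) {..n}"
    by (rule linorder_inj_onI) (use less in auto)
  moreover have "ins_incr n D ` {..n} \<subseteq> {..n}"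
  proof (intro image_subsetI)
    fix j assume j: "j \<in> {..n}"
    have "?c j \<le> j" using card_mono[of "{..<j}" "{i \<in> D. i < j}"] by auto
    then show "ins_incr n D j \<in> {..n}" using j by (auto simp: ins_incr_def)
  qed
  ultimately show ?thesis
    unfolding bij_betw_def using endo_inj_surj[OF finite_atMost] by blast
qed

text \<open>By injectivity slot 0 is the only one with increment \<open>n\<close>, so reindexing by
  the increment attaches \<open>t\<close> to the power \<open>q ^ n\<close>.\<close>

lemma sum_ins_incr:
  fixes q :: "'a :: comm_semiring_1"
  assumes D: "D \<subseteq> {1..n - 1}"
  shows "(\<Sum>j\<le>n. q ^ ins_incr n D j * (if j = 0 then t else 1)) = (\<Sum>i<n. q ^ i) + q ^ n * t"
proof -
  have bij: "bij_betw (ins_incr n D) {..n} {..n}" using bij_betw_ins_incr[OF D] .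
  have "j = 0 \<longleftrightarrow> ins_incr n D j = n" if "j \<le> n" for j
    using inj_onD[OF bij_betw_imp_inj_on[OF bij], of j 0] that ins_incr_0[OF D] by auto
  then have "(\<Sum>j\<le>n. q ^ ins_incr n D j * (if j = 0 then t else 1))
      = (\<Sum>j\<le>n. q ^ ins_incr n D j * (if ins_incr n D j = n then t else 1))"
    by (intro sum.cong) auto
  also have "\<dots> = (\<Sum>i\<le>n. q ^ i * (if i = n then t else 1))"
    by (rule sum.reindex_bij_betw[OF bij])
  also have "\<dots> = (\<Sum>i<n. q ^ i) + q ^ n * t"
    by (simp flip: lessThan_Suc_atMost)
  finally show ?thesis .
qed

text \<open>For an empty descent set the increment at slot \<open>j\<close> is \<open>n - j\<close>,
  which is also the number of inversions created there. The length case is thus an instance of the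
  major index case.\<close>

lemma sum_power_diff:
  fixes q :: "'a :: comm_semiring_1"
  shows "(\<Sum>j\<le>n. q ^ (n - j) * (if j = 0 then t else 1)) = (\<Sum>i<n. q ^ i) + q ^ n * t"
  using sum_ins_incr[of "{}" n q t] by (simp add: ins_incr_def)

section \<open>Insertion as right multiplication by a cycle\<close>

text \<open>
  Composing with \<open>ins_cycle k m\<close> on the right inserts \<open>m\<close> at position \<open>k\<close> of the one-line notation;
  \<open>skip k\<close> sends old positions to new ones.
\<close>

definition ins_cycle :: "nat \<Rightarrow> nat \<Rightarrow> nat \<Rightarrow> nat" where
  "ins_cycle k m i = (if i < k \<or> i > m then i else if i = k then m else i - 1)"

definition skip :: "nat \<Rightarrow> nat \<Rightarrow> nat" where
  "skip k i = (if i < k then i else Suc i)"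

lemma ins_cycle_self [simp]: "ins_cycle m m = id"
  by (auto simp: ins_cycle_def fun_eq_iff)

lemma ins_cycle_skip: "\<lbrakk>k \<le> Suc m; i \<le> m\<rbrakk> \<Longrightarrow> ins_cycle k (Suc m) (skip k i) = i"
  by (auto simp: ins_cycle_def skip_def)

lemma skip_less_iff [simp]: "skip k i < skip k j \<longleftrightarrow> i < j"
  by (auto simp: skip_def)

lemma skip_neq [simp]: "skip k i \<noteq> k" "k \<noteq> skip k i"
  by (auto simp: skip_def)

lemma inj_skip: "inj_on (skip k) A"
  by (auto simp: inj_on_def skip_def split: if_splits)

lemma atLeastAtMost_Suc_skip:
  "\<lbrakk>1 \<le> k; k \<le> Suc m\<rbrakk> \<Longrightarrow> {1..Suc m} = insert k (skip k ` {1..m})"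
proof (intro equalityI subsetI)
  fix i assume *: "1 \<le> k" "k \<le> Suc m" "i \<in> {1..Suc m}"
  show "i \<in> insert k (skip k ` {1..m})"
  proof (cases "i = k")
    case False
    then have "i = skip k (if i < k then i else i - 1)" "(if i < k then i else i - 1) \<in> {1..m}"
      using * by (auto simp: skip_def)
    then show ?thesis by blast
  qed simp
qed (auto simp: skip_def split: if_splits)

text \<open>A simple transposition on the left extends the cycle upwards, which evaluates descending
  words. The companion lemma extends it downwards from the right, as the word ending in the inverse
  of a_1 requires.\<close>

lemma s_gen_ins_cycle: "k \<le> m \<Longrightarrow> s_gen m \<circ> ins_cycle k m = ins_cycle k (Suc m)"
  by (auto simp: s_gen_def ins_cycle_def transpose_def fun_eq_iff)

lemma ins_cycle_s_gen: "k < m \<Longrightarrow> ins_cycle (Suc k) m \<circ> s_gen k = ins_cycle k m"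
  by (auto simp: s_gen_def ins_cycle_def transpose_def fun_eq_iff)

lemma permutes_ins_cycle:
  assumes "k \<le> m" shows "ins_cycle k m permutes {k..m}"
  using assms
proof (induction m rule: dec_induct)
  case base
  show ?case using permutes_id by (simp only: ins_cycle_self)
next
  case (step m)
  have "s_gen m permutes {k..Suc m}"
    unfolding s_gen_def using step by (intro permutes_swap_id) auto
  moreover have "ins_cycle k m permutes {k..Suc m}"
    using step.IH by (rule permutes_subset) auto
  ultimately show ?case
    using permutes_compose s_gen_ins_cycle step.hyps by metis
qed

section \<open>The symmetric group\<close>

lemma bounds_permutes: "\<lbrakk>p permutes {1..m}; i \<in> {1..m}\<rbrakk> \<Longrightarrow> p i \<in> {1..m}" for m :: nat
  by (simp only: permutes_in_image)

lemma insert_apply: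
  assumes "p permutes {1..m}" "1 \<le> k" "k \<le> Suc m" "i \<le> Suc m"
  shows "(p \<circ> ins_cycle k (Suc m)) i = (if i < k then p i else if i = k then Suc m else p (i - 1))"
  using assms permutes_not_in[OF assms(1), of "Suc m"] by (auto simp: ins_cycle_def)

lemma insert_apply_skip:
  assumes "p permutes {1..m}" "k \<le> Suc m" "i \<le> m"
  shows "(p \<circ> ins_cycle k (Suc m)) (skip k i) = p i"
  using assms by (simp add: ins_cycle_skip)

lemma insert_permutes:
  assumes "p permutes {1..m}" "1 \<le> k" "k \<le> Suc m"
  shows "p \<circ> ins_cycle k (Suc m) permutes {1..Suc m}"
proof (rule permutes_compose)
  show "ins_cycle k (Suc m) permutes {1..Suc m}"
    by (rule permutes_subset[OF permutes_ins_cycle]) (use assms in auto)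
  show "p permutes {1..Suc m}"
    using assms(1) by (rule permutes_subset) auto
qed

text \<open>The position of the value \<open>Suc m\<close> recovers \<open>k\<close>; cancelling the
  surjective cycle then recovers \<open>p\<close>.\<close>

lemma insert_inject:
  assumes p: "p permutes {1..m}" "1 \<le> k" "k \<le> Suc m"
    and p': "p' permutes {1..m}" "1 \<le> k'" "k' \<le> Suc m"
    and eq: "p \<circ> ins_cycle k (Suc m) = p' \<circ> ins_cycle k' (Suc m)"
  shows "p = p' \<and> k = k'"
proof -
  have "(p \<circ> ins_cycle k (Suc m)) k = (p' \<circ> ins_cycle k' (Suc m)) k'"
    using p p' by (simp add: insert_apply del: o_apply)
  then have k: "k = k'"
    using injD[OF permutes_inj[OF insert_permutes[OF p']]] eq by metis
  have "surj (ins_cycle k (Suc m))"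
    using permutes_ins_cycle[OF p(3)] by (rule permutes_surj)
  then have "p = p'"
    using eq k by (metis surj_fun_eq)
  then show ?thesis using k by simp
qed

text \<open>Old inversions are transported by \<open>skip k\<close>. The new maximum forms an
  inversion with each of the \<open>Suc m - k\<close> positions to its right and with none to its
  left.\<close>

lemma len_S_insert:
  assumes p: "p permutes {1..m}" and k: "1 \<le> k" "k \<le> Suc m"
  shows "len_S (Suc m) (p \<circ> ins_cycle k (Suc m)) = len_S m p + (Suc m - k)"
proof -
  let ?P = "p \<circ> ins_cycle k (Suc m)"
  let ?I = "{(i, j). 1 \<le> i \<and> i < j \<and> j \<le> m \<and> p i > p j}"
  let ?J = "{(i, j). 1 \<le> i \<and> i < j \<and> j \<le> Suc m \<and> ?P i > ?P j}"
  have Pk: "?P k = Suc m" using insert_apply[OF p k k(2)] by simp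
  have Ps: "?P (skip k i) = p i" if "i \<in> {1..m}" for i
    using insert_apply_skip[OF p k(2)] that by simp
  have le: "p i < Suc m" if "i \<in> {1..m}" for i using bounds_permutes[OF p that] by simp
  have mem: "(i, j) \<in> ?J \<longleftrightarrow> i \<in> {1..Suc m} \<and> j \<in> {1..Suc m} \<and> i < j \<and> ?P i > ?P j" for i j
    by (auto simp del: o_apply)
  have J: "?J = map_prod (skip k) (skip k) ` ?I \<union> Pair k ` {k<..Suc m}"
  proof (intro equalityI subsetI)
    fix x assume x: "x \<in> ?J"
    obtain i j where ij: "x = (i, j)" by (cases x)
    have "i \<in> insert k (skip k ` {1..m})" "j \<in> insert k (skip k ` {1..m})" "i < j" "?P i > ?P j"
      using x[unfolded ij mem] unfolding atLeastAtMost_Suc_skip[OF k] by simp_all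
    then consider (k) "i = k" "j \<in> {k<..Suc m}" | (k') b where "i = skip k b" "b \<in> {1..m}" "j = k"
      | (skip) b c where "i = skip k b" "j = skip k c" "b \<in> {1..m}" "c \<in> {1..m}"
      using x[unfolded ij mem] by force
    then show "x \<in> map_prod (skip k) (skip k) ` ?I \<union> Pair k ` {k<..Suc m}"
    proof cases
      case k
      then show ?thesis using ij by simp
    next
      case k'
      then show ?thesis using \<open>?P i > ?P j\<close> Pk Ps[of b] le[of b] by simp
    next
      case skip
      then have "(b, c) \<in> ?I" using \<open>i < j\<close> \<open>?P i > ?P j\<close> Ps[of b] Ps[of c] by simp
      then have "map_prod (skip k) (skip k) (b, c) \<in> map_prod (skip k) (skip k) ` ?I" by (rule imageI)
      then show ?thesis using skip ij by simp
    qed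
  next
    fix x assume "x \<in> map_prod (skip k) (skip k) ` ?I \<union> Pair k ` {k<..Suc m}"
    then show "x \<in> ?J"
    proof
      assume "x \<in> map_prod (skip k) (skip k) ` ?I"
      then obtain i j where ij: "x = (skip k i, skip k j)" "1 \<le> i" "i < j" "j \<le> m" "p i > p j" by auto
      moreover from ij have "skip k i \<in> {1..Suc m}" "skip k j \<in> {1..Suc m}" by (auto simp: skip_def)
      ultimately show ?thesis using mem Ps by (simp del: o_apply)
    next
      assume "x \<in> Pair k ` {k<..Suc m}"
      then obtain j where j: "x = (k, j)" "k < j" "j \<le> Suc m" by auto
      then have "j \<in> insert k (skip k ` {1..m})" 
        unfolding atLeastAtMost_Suc_skip[OF k, symmetric] using k by simp
      then show ?thesis using mem j k Pk Ps le by (auto simp del: o_apply)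
    qed
  qed
  have "finite ?I" by (rule finite_subset[of _ "{1..m} \<times> {1..m}"]) auto
  then have "card ?J = card (map_prod (skip k) (skip k) ` ?I) + card (Pair k ` {k<..Suc m})"
    unfolding J by (intro card_Un_disjoint) (auto simp: skip_def split: if_splits)
  also have "card (map_prod (skip k) (skip k) ` ?I) = card ?I"
    by (rule card_image) (auto simp: inj_on_def skip_def split: if_splits)
  also have "card (Pair k ` {k<..Suc m}) = Suc m - k"
    by (subst card_image) (auto simp: inj_on_def)
  finally show ?thesis by (simp add: len_S_def)
qed

lemma Des_S_insert:
  assumes p: "p permutes {1..m}" and j: "j \<le> m"
  shows "Des_S (Suc m) (p \<circ> ins_cycle (Suc j) (Suc m)) = ins_des m j (Des_S m p)"
proof (rule Set.set_eqI)
  fix i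
  let ?P = "p \<circ> ins_cycle (Suc j) (Suc m)"
  have P: "?P i = (if i < Suc j then p i else if i = Suc j then Suc m else p (i - 1))" if "i \<le> Suc m" for i
    using insert_apply[OF p] that j by simp
  have le: "p i < Suc m" if "i \<in> {1..m}" for i using bounds_permutes[OF p that] by simp
  have D: "i \<in> Des_S (Suc m) ?P \<longleftrightarrow> 1 \<le> i \<and> i \<le> m \<and> ?P i > ?P (Suc i)" for i
    by (auto simp: Des_S_def)
  have D': "i \<in> Des_S m p \<longleftrightarrow> 1 \<le> i \<and> Suc i \<le> m \<and> p i > p (Suc i)" for i
    by (auto simp: Des_S_def)
  show "i \<in> Des_S (Suc m) ?P \<longleftrightarrow> i \<in> ins_des m j (Des_S m p)"
  proof (cases "i \<in> {1..m}")
    case False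
    then show ?thesis using j unfolding D mem_ins_des D' by auto
  next
    case True
    \<comment> \<open>At \<open>i = j\<close> the maximum is the right neighbour, so there is no
      descent; at \<open>i = Suc j\<close> it is the left one, so there is. Beyond that, positions
      are shifted by one.\<close>
    consider "i < j" | "i = j" | "i = Suc j" | "Suc j < i" by linarith
    then show ?thesis
      using True j le[of i] unfolding D mem_ins_des D' by cases (auto simp: P simp del: o_apply)
  qed
qed

lemma Des_S_subset: "Des_S n p \<subseteq> {1..n - 1}"
  by (auto simp: Des_S_def)

lemma rmaj_S_insert:
  assumes "p permutes {1..m}" "j \<le> m"
  shows "rmaj_S (Suc m) (p \<circ> ins_cycle (Suc j) (Suc m)) = rmaj_S m p + ins_incr m (Des_S m p) j"
  unfolding rmaj_S_def Des_S_insert[OF assms] using sum_ins_des[OF Des_S_subset assms(2)] .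

section \<open>The transversals \<open>R_S\<close> and the statistic \<open>del_S\<close>\<close>

lemma word_prod_s_gen: "j \<le> n \<Longrightarrow> word_prod s_gen (rev [Suc j..<Suc n]) = ins_cycle (Suc j) (Suc n)"
proof (induction n rule: dec_induct)
  case (step n)
  then show ?case using s_gen_ins_cycle[of "Suc j" "Suc n"] by simp
qed simp

text \<open>The index \<open>j = k - 1\<close> counts the entries left of the inserted one and so
  agrees with the slots of \<open>ins_incr\<close>.\<close>

lemma R_S_eq: "R_S n = (\<lambda>j. rev [Suc j..<Suc n]) ` {..n}"
proof (intro equalityI subsetI)
  fix w assume "w \<in> R_S n"
  then obtain k where "w = rev [k..<Suc n]" "1 \<le> k" "k \<le> n + 1" by (auto simp: R_S_def)
  then show "w \<in> (\<lambda>j. rev [Suc j..<Suc n]) ` {..n}" by (intro image_eqI[of _ _ "k - 1"]) auto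
next
  fix w assume "w \<in> (\<lambda>j. rev [Suc j..<Suc n]) ` {..n}"
  then obtain j where "w = rev [Suc j..<Suc n]" "j \<le> n" by blast
  then show "w \<in> R_S n" unfolding R_S_def by (intro CollectI exI[of _ "Suc j"]) simp
qed

lemma inj_on_rev_upt: "inj_on (\<lambda>j. rev [Suc j..<Suc n]) {..n}"
proof (rule inj_onI)
  fix i j assume "i \<in> {..n}" "j \<in> {..n}" "rev [Suc i..<Suc n] = rev [Suc j..<Suc n]"
  then have "length (rev [Suc i..<Suc n]) = length (rev [Suc j..<Suc n])" by simp
  then have "Suc n - Suc i = Suc n - Suc j" by (simp only: length_rev length_upt)
  then show "i = j" using \<open>i \<in> {..n}\<close> \<open>j \<in> {..n}\<close> by simp
qed

text \<open>Surjectivity comes from counting: the map is injective and (n+1) n! = (n+1)!.\<close>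

interpretation S: transversal_chain s_gen R_S "\<lambda>n. carrier (sym_group n)"
proof
  show "carrier (sym_group (Suc 0)) = {id}"
    by (auto simp: sym_group_def permutes_sing id_def)
next
  fix n :: nat assume n: "n \<ge> 1"
  let ?f = "\<lambda>(p, w). p \<circ> word_prod s_gen w"
  let ?A = "carrier (sym_group n) \<times> R_S n" and ?B = "carrier (sym_group (Suc n))"
  have fin: "finite (carrier (sym_group m))" for m
    using sym_group_card_carrier[of m] card.infinite by fastforce
  have inj: "inj_on ?f ?A"
  proof (rule inj_onI)
    fix x y assume "x \<in> ?A" "y \<in> ?A" and eq: "?f x = ?f y"
    then obtain p j p' j' where x: "x = (p, rev [Suc j..<Suc n])" "p permutes {1..n}" "j \<le> n"
      and y: "y = (p', rev [Suc j'..<Suc n])" "p' permutes {1..n}" "j' \<le> n"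
      unfolding R_S_eq by (auto simp: sym_group_carrier)
    have "p = p' \<and> Suc j = Suc j'"
      using x y eq by (intro insert_inject[of p n _ p']) (simp_all add: word_prod_s_gen del: upt_Suc)
    then show "x = y" using x y by simp
  qed
  moreover have sub: "?f ` ?A \<subseteq> ?B"
    using insert_permutes unfolding R_S_eq
    by (auto simp: sym_group_carrier word_prod_s_gen simp del: upt_Suc)
  moreover have "card (?f ` ?A) = card ?B"
  proof -
    have "card (R_S n) = Suc n"
      unfolding R_S_eq by (subst card_image[OF inj_on_rev_upt]) simp
    then show ?thesis
      unfolding card_image[OF inj] card_cartesian_product sym_group_card_carrier by simp
  qed
  ultimately show "bij_betw ?f ?A ?B"
    using card_subset_eq[OF fin sub] by (simp add: bij_betw_def)
qed

lemma factors_S_eq: "factors_S = S.factors"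
  by (simp add: factors_S_def S.factors_def fun_eq_iff)

text \<open>The appended word is the full word s_n ... s_1 exactly for \<open>j = 0\<close>, and the
  earlier factors are unchanged.\<close>

lemma del_S_Suc:
  assumes "n \<ge> 1" "p \<in> carrier (sym_group n)" "j \<le> n"
  shows "del_S (Suc n) (p \<circ> ins_cycle (Suc j) (Suc n)) = del_S n p + (if j = 0 then 1 else 0)"
proof -
  let ?w = "rev [Suc j..<Suc n]" and ?fs = "factors_S n p"
  have w: "?w \<in> R_S n" using assms by (auto simp: R_S_eq simp del: upt_Suc)
  have fac: "factors_S (Suc n) (p \<circ> ins_cycle (Suc j) (Suc n)) = ?fs @ [?w]"
    using S.factors_Suc[OF assms(1,2) w] assms by (simp add: factors_S_eq word_prod_s_gen del: upt_Suc)
  have len: "length ?fs = n - 1" using S.length_factors assms by (simp add: factors_S_eq)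
  have eq: "?w = rev [1..<Suc n] \<longleftrightarrow> j = 0"
    using inj_onD[OF inj_on_rev_upt[of n], of j 0] assms by auto
  let ?D = "{i \<in> {1..n - 1}. ?fs ! (i - 1) = rev [1..<Suc i]}"
  have "{i \<in> {1..Suc n - 1}. (?fs @ [?w]) ! (i - 1) = rev [1..<Suc i]} = ?D \<union> (if j = 0 then {n} else {})"
  proof (rule Set.set_eqI)
    fix i
    consider "i = n" | "i \<in> {1..n - 1}" | "i \<notin> {1..n}" by force
    then show "i \<in> {i \<in> {1..Suc n - 1}. (?fs @ [?w]) ! (i - 1) = rev [1..<Suc i]}
      \<longleftrightarrow> i \<in> ?D \<union> (if j = 0 then {n} else {})"
    proof cases
      case 1
      have "(?fs @ [?w]) ! (n - 1) = ?w" using len by (metis nth_append_length)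
      then show ?thesis using 1 eq assms(1) by (auto simp del: upt_Suc)
    next
      case 2
      then have "i - 1 < length ?fs" using len by auto
      then show ?thesis using 2 by (auto simp: nth_append simp del: upt_Suc)
    next
      case 3
      then show ?thesis using assms(1) by auto
    qed
  qed
  then have "del_S (Suc n) (p \<circ> ins_cycle (Suc j) (Suc n)) = card (?D \<union> (if j = 0 then {n} else {}))"
    unfolding del_S_def fac by simp
  also have "\<dots> = card ?D + (if j = 0 then 1 else 0)"
    using assms(1) by (subst card_Un_disjoint) auto
  finally show ?thesis unfolding del_S_def .
qed

lemma sum_R_S: "(\<Sum>w\<in>R_S n. F (word_prod s_gen w)) = (\<Sum>j\<le>n. F (ins_cycle (Suc j) (Suc n)))"
  unfolding R_S_eq
  by (subst sum.reindex[OF inj_on_rev_upt]) (simp add: word_prod_s_gen del: upt_Suc)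

lemma S_1: "del_S (Suc 0) p = 0" "len_S (Suc 0) p = 0" "rmaj_S (Suc 0) p = 0"
proof -
  have "{(i, j). 1 \<le> i \<and> i < j \<and> j \<le> Suc 0 \<and> p i > p j} = {}" by auto
  then show "len_S (Suc 0) p = 0" unfolding len_S_def by (simp only: card.empty)
qed (auto simp: del_S_def rmaj_S_def Des_S_def)

section \<open>Generating functions over the symmetric group\<close>

lemma sum_len_S:
  fixes q t :: "'a :: comm_semiring_1"
  assumes "n \<ge> 1"
  shows "(\<Sum>\<sigma>\<in>carrier (sym_group n). q ^ len_S n \<sigma> * t ^ del_S n \<sigma>)
    = (\<Prod>j = 1..n - 1. (\<Sum>i<j. q ^ i) + q ^ j * t)"
proof (rule S.sum_eq_prod)
  fix n p assume n: "1 \<le> n" and p: "p \<in> carrier (sym_group n)"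
  have "(\<Sum>w\<in>R_S n. q ^ len_S (Suc n) (p \<circ> word_prod s_gen w) * t ^ del_S (Suc n) (p \<circ> word_prod s_gen w))
      = (\<Sum>j\<le>n. (q ^ len_S n p * t ^ del_S n p) * (q ^ (n - j) * (if j = 0 then t else 1)))"
    unfolding sum_R_S[where F = "\<lambda>c. q ^ len_S (Suc n) (p \<circ> c) * t ^ del_S (Suc n) (p \<circ> c)"]
    using n p by (intro sum.cong refl)
      (simp add: len_S_insert del_S_Suc sym_group_carrier power_add mult_ac del: Nat.add_diff_assoc)
  then show "(\<Sum>w\<in>R_S n. q ^ len_S (Suc n) (p \<circ> word_prod s_gen w) * t ^ del_S (Suc n) (p \<circ> word_prod s_gen w))
      = (q ^ len_S n p * t ^ del_S n p) * ((\<Sum>i<n. q ^ i) + q ^ n * t)"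
    by (simp only: sum_power_diff flip: sum_distrib_left)
qed (use assms in \<open>simp_all add: S_1\<close>)

lemma sum_rmaj_S:
  fixes q t :: "'a :: comm_semiring_1"
  assumes "n \<ge> 1"
  shows "(\<Sum>\<sigma>\<in>carrier (sym_group n). q ^ rmaj_S n \<sigma> * t ^ del_S n \<sigma>)
    = (\<Prod>j = 1..n - 1. (\<Sum>i<j. q ^ i) + q ^ j * t)"
proof (rule S.sum_eq_prod)
  fix n p assume n: "1 \<le> n" and p: "p \<in> carrier (sym_group n)"
  have "(\<Sum>w\<in>R_S n. q ^ rmaj_S (Suc n) (p \<circ> word_prod s_gen w) * t ^ del_S (Suc n) (p \<circ> word_prod s_gen w))
      = (\<Sum>j\<le>n. (q ^ rmaj_S n p * t ^ del_S n p) *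
          (q ^ ins_incr n (Des_S n p) j * (if j = 0 then t else 1)))"
    unfolding sum_R_S[where F = "\<lambda>c. q ^ rmaj_S (Suc n) (p \<circ> c) * t ^ del_S (Suc n) (p \<circ> c)"]
    using n p by (intro sum.cong refl)
      (simp add: rmaj_S_insert del_S_Suc sym_group_carrier power_add mult_ac)
  then show "(\<Sum>w\<in>R_S n. q ^ rmaj_S (Suc n) (p \<circ> word_prod s_gen w) * t ^ del_S (Suc n) (p \<circ> word_prod s_gen w))
      = (q ^ rmaj_S n p * t ^ del_S n p) * ((\<Sum>i<n. q ^ i) + q ^ n * t)"
    by (simp only: sum_ins_incr[OF Des_S_subset] flip: sum_distrib_left)
qed (use assms in \<open>simp_all add: S_1\<close>)

section \<open>The alternating group\<close>

lemma permutes_s_gen: "\<lbrakk>1 \<le> i; i < m\<rbrakk> \<Longrightarrow> s_gen i permutes {1..m}"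
  unfolding s_gen_def by (intro permutes_swap_id) auto

lemma s_gen_apply [simp]:
  "s_gen i i = Suc i" "s_gen i (Suc i) = i" "\<lbrakk>j \<noteq> i; j \<noteq> Suc i\<rbrakk> \<Longrightarrow> s_gen i j = j"
  by (simp_all add: s_gen_def)

lemma s_gen_s_gen [simp]: "s_gen i (s_gen i j) = j"
  by (simp add: s_gen_def)

lemma permutation_s_gen: "permutation (s_gen i)"
  by (simp add: s_gen_def permutation_swap_id)

section \<open>Parity and evaluation of the words in \<open>R_A\<close>\<close>

lemma evenperm_a_letter: "permutation (a_letter x) \<and> evenperm (a_letter x)"
proof -
  have "permutation (a_gen i) \<and> evenperm (a_gen i)" for i
    by (simp add: a_gen_def permutation_compose permutation_s_gen evenperm_comp)
      (simp add: s_gen_def evenperm_swap)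
  then show ?thesis by (simp add: a_letter_def permutation_inverse evenperm_inv)
qed

lemma evenperm_word_prod: "permutation (word_prod a_letter w) \<and> evenperm (word_prod a_letter w)"
proof (induction w)
  case Nil
  then show ?case using permutation_id by (simp add: id_def)
next
  case (Cons x w)
  then show ?case using evenperm_a_letter[of x]
    by (simp add: permutation_compose evenperm_comp del: o_apply)
qed

text \<open>The word of \<open>R_A n\<close> that inserts \<open>n + 2\<close> at position \<open>k + 1\<close>.\<close>

definition a_word :: "nat \<Rightarrow> nat \<Rightarrow> (nat \<times> bool) list" where
  "a_word n k = (if k = 0 then map (\<lambda>i. (i, True)) (rev [2..<Suc n]) @ [(1, False)]
     else map (\<lambda>i. (i, True)) (rev [k..<Suc n]))"

lemma R_A_eq: "R_A n = a_word n ` {..Suc n}"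
proof -
  have "a_word n ` {..Suc n} = insert (a_word n 0) (a_word n ` {1..Suc n})"
    by (metis One_nat_def atMost_atLeast0 atLeast0_atMost_Suc_eq_insert_0 image_Suc_atLeastAtMost image_insert)
  also have "a_word n ` {1..Suc n} = {map (\<lambda>i. (i, True)) (rev [k..<Suc n]) |k. 1 \<le> k \<and> k \<le> n + 1}"
    by (force simp: a_word_def image_iff simp del: upt_Suc)
  finally show ?thesis by (simp add: R_A_def a_word_def del: upt_Suc)
qed

text \<open>Truncated subtraction is intended: \<open>k = 0\<close> and \<open>k = 1\<close> are the
  two words of length \<open>n\<close>, ending in the inverse of a_1 and in a_1. The same
  \<open>k - 1\<close> is the slot in all later formulas.\<close>

lemma length_a_word: "n \<ge> 1 \<Longrightarrow> length (a_word n k) = n - (k - 1)"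
  by (auto simp: a_word_def simp del: upt_Suc)

text \<open>The inverse letter singles out \<open>k = 0\<close>; the length separates all other
  indices.\<close>

lemma inj_on_a_word: 
  assumes "n \<ge> 1" shows "inj_on (a_word n) {..Suc n}"
proof (rule inj_onI)
  fix k l assume *: "k \<in> {..Suc n}" "l \<in> {..Suc n}" "a_word n k = a_word n l"
  have "(1, False) \<in> set (a_word n k) \<longleftrightarrow> k = 0" for k
    by (auto simp: a_word_def simp del: upt_Suc)
  then have "k = 0 \<longleftrightarrow> l = 0" using * by metis
  moreover have "n - (k - 1) = n - (l - 1)" using length_a_word[OF assms] * by metis
  ultimately show "k = l" using * by auto
qed

lemma count_a_word:
  assumes "n \<ge> 1" "k \<le> Suc n"
  shows "length (filter (\<lambda>x. fst x = 1) (a_word n k)) = (if k - 1 = 0 then 1 else 0)"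
proof -
  have "filter (\<lambda>i. i = 1) [k..<Suc n] = []" if "k > 1" for k
    using that by (auto simp: filter_empty_conv)
  moreover have "[1..<Suc n] = 1 # [2..<Suc n]"
    using upt_conv_Cons[of 1 "Suc n"] assms by (simp add: numeral_2_eq_2)
  moreover have "k = 0 \<or> k = 1 \<or> k > 1" by linarith
  ultimately show ?thesis
    by (auto simp: a_word_def filter_map o_def rev_filter[symmetric] simp del: upt_Suc)
qed

lemma s_gen_commute:
  assumes "i + 2 \<le> j"
  shows "s_gen j \<circ> (s_gen i ^^ e) = (s_gen i ^^ e) \<circ> s_gen j"
proof (induction e)
  case (Suc e)
  have *: "s_gen j \<circ> s_gen i = s_gen i \<circ> s_gen j"
    using assms by (auto simp: fun_eq_iff s_gen_def transpose_def)
  have "s_gen j \<circ> (s_gen i \<circ> (s_gen i ^^ e)) = s_gen i \<circ> (s_gen j \<circ> (s_gen i ^^ e))"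
    unfolding comp_assoc[symmetric] * ..
  then show ?case unfolding Suc.IH funpow.simps(2) comp_assoc .
qed simp

lemma word_prod_a_gen:
  "j \<le> n \<Longrightarrow> word_prod a_letter (map (\<lambda>i. (i, True)) (rev [Suc j..<Suc n]))
    = (s_gen 1 ^^ (n - j)) \<circ> ins_cycle (j + 2) (n + 2)"
proof (induction n rule: dec_induct)
  case (step n)
  have "word_prod a_letter (map (\<lambda>i. (i, True)) (rev [Suc j..<Suc (Suc n)]))
      = s_gen 1 \<circ> s_gen (n + 2) \<circ> ((s_gen 1 ^^ (n - j)) \<circ> ins_cycle (j + 2) (n + 2))"
    using step.hyps(1) unfolding step.IH[symmetric] by (simp add: a_letter_def a_gen_def del: o_apply)
  also have "\<dots> = s_gen 1 \<circ> (s_gen (n + 2) \<circ> (s_gen 1 ^^ (n - j))) \<circ> ins_cycle (j + 2) (n + 2)"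
    by (simp only: comp_assoc)
  also have "\<dots> = (s_gen 1 \<circ> (s_gen 1 ^^ (n - j))) \<circ> (s_gen (n + 2) \<circ> ins_cycle (j + 2) (n + 2))"
  proof -
    \<comment> \<open>For \<open>n = 0\<close> the two transpositions overlap, but then the exponent
      \<open>n - j\<close> is 0. For \<open>n \<ge> 1\<close> they are disjoint.\<close>
    have "s_gen (n + 2) \<circ> (s_gen 1 ^^ (n - j)) = (s_gen 1 ^^ (n - j)) \<circ> s_gen (n + 2)"
      by (cases "n = 0") (simp_all add: s_gen_commute del: o_apply)
    then show ?thesis by (simp only: comp_assoc)
  qed
  also have "\<dots> = (s_gen 1 ^^ (Suc n - j)) \<circ> ins_cycle (j + 2) (Suc n + 2)"
    using step.hyps by (subst s_gen_ins_cycle) (simp_all add: Suc_diff_le del: o_apply)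
  finally show ?case .
qed simp

text \<open>
  As \<open>s\<^sub>1\<close> commutes with \<open>s\<^sub>3, s\<^sub>4, \<dots>\<close>, the letters \<open>s\<^sub>1\<close> can be collected in front of the
  inserting cycle.
\<close>

lemma word_prod_a_word:
  assumes "n \<ge> 1" "k \<le> Suc n"
  obtains e where "word_prod a_letter (a_word n k) = (s_gen 1 ^^ e) \<circ> ins_cycle (Suc k) (Suc (n + 1))"
proof (cases "k = 0")
  case False
  then show ?thesis
    using that[of "n - (k - 1)"] word_prod_a_gen[of "k - 1" n] assms by (simp add: a_word_def del: upt_Suc o_apply)
next
  case True
  have "inv_into UNIV (s_gen 1 \<circ> s_gen 2) = s_gen 2 \<circ> s_gen 1"
    by (rule inv_equality) simp_all
  \<comment> \<open>The word a_n ... a_2 yields the cycle with lower end 3; the trailing s_2 s_1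
    brings this end down to 1.\<close>
  then have "word_prod a_letter (a_word n k)
      = (s_gen 1 ^^ (n - 1)) \<circ> ins_cycle 3 (n + 2) \<circ> (s_gen 2 \<circ> s_gen 1)"
    using True word_prod_a_gen[of 1 n] assms
    by (simp add: a_word_def a_letter_def a_gen_def numeral_2_eq_2 numeral_3_eq_3 del: upt_Suc o_apply)
  also have "\<dots> = (s_gen 1 ^^ (n - 1)) \<circ> (ins_cycle 3 (n + 2) \<circ> s_gen 2 \<circ> s_gen 1)"
    by (simp only: comp_assoc)
  also have "ins_cycle 3 (n + 2) \<circ> s_gen 2 = ins_cycle 2 (n + 2)"
    using ins_cycle_s_gen[of 2 "n + 2"] assms by (simp add: numeral_3_eq_3)
  also have "ins_cycle 2 (n + 2) \<circ> s_gen 1 = ins_cycle 1 (n + 2)"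
    using ins_cycle_s_gen[of 1 "n + 2"] assms by (simp add: numeral_2_eq_2)
  finally show ?thesis using that[of "n - 1"] True by (simp del: o_apply)
qed

lemma permutes_s_gen_pow:
  assumes "p permutes {1..n + 1}" "n \<ge> 1"
  shows "p \<circ> (s_gen 1 ^^ e) permutes {1..n + 1}"
  by (rule permutes_compose[OF permutes_funpow[OF permutes_s_gen] assms(1)]) (use assms(2) in auto)

text \<open>Surjectivity again comes from counting: \<open>R_A n\<close> has n+2 words and |A_{n+2}|
  = (n+2) |A_{n+1}|.\<close>

interpretation A: transversal_chain a_letter R_A "\<lambda>n. carrier (alt_group (n + 1))"
proof
  have "finite (carrier (alt_group 2))"
    unfolding alt_group_def by (simp add: finite_permutations)
  moreover have "card (carrier (alt_group 2)) = 1"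
    using alt_group_card_carrier[of 2] by simp
  moreover have "id \<in> carrier (alt_group 2)"
    by (simp only: alt_group_carrier permutes_id evenperm_id)
  ultimately have "carrier (alt_group 2) = {id}"
    by (metis card_1_singletonE singletonD)
  then show "carrier (alt_group (Suc 0 + 1)) = {id}"
    by (simp add: numeral_2_eq_2)
next
  fix n :: nat assume n: "n \<ge> 1"
  let ?f = "\<lambda>(p, w). p \<circ> word_prod a_letter w"
  let ?A = "carrier (alt_group (n + 1)) \<times> R_A n" and ?B = "carrier (alt_group (Suc n + 1))"
  have fin: "finite ?B"
    unfolding alt_group_def by (simp add: finite_permutations)
  have inj: "inj_on ?f ?A"
  proof (rule inj_onI)
    fix x y assume "x \<in> ?A" "y \<in> ?A" and eq: "?f x = ?f y"
    then obtain p k p' k' where x: "x = (p, a_word n k)" "p permutes {1..n + 1}" "k \<le> Suc n"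
      and y: "y = (p', a_word n k')" "p' permutes {1..n + 1}" "k' \<le> Suc n"
      unfolding R_A_eq by (auto simp: alt_group_carrier)
    obtain e where e: "word_prod a_letter (a_word n k) = (s_gen 1 ^^ e) \<circ> ins_cycle (Suc k) (Suc (n + 1))"
      using word_prod_a_word[OF n x(3)] .
    obtain e' where e': "word_prod a_letter (a_word n k') = (s_gen 1 ^^ e') \<circ> ins_cycle (Suc k') (Suc (n + 1))"
      using word_prod_a_word[OF n y(3)] .
    \<comment> \<open>Absorbing the powers of s_1 into \<open>p\<close> and \<open>p'\<close> leaves
      two plain insertions, so the positions agree. Then the words coincide and can be
      cancelled.\<close>
    have "Suc k = Suc k'"
      using insert_inject[OF permutes_s_gen_pow[OF x(2) n, of e] _ _ permutes_s_gen_pow[OF y(2) n, of e'], of "Suc k" "Suc k'"]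
        eq[unfolded x(1) y(1) prod.case e e', folded comp_assoc] x(3) y(3) by simp
    moreover have "p = p'"
    proof (rule surj_fun_eq)
      show "word_prod a_letter (a_word n k) ` UNIV = UNIV"
        using evenperm_word_prod permutation_bijective bij_is_surj by blast
      show "\<forall>z\<in>UNIV. (p \<circ> word_prod a_letter (a_word n k)) z = (p' \<circ> word_prod a_letter (a_word n k)) z"
        using eq x(1) y(1) \<open>Suc k = Suc k'\<close> by simp
    qed
    ultimately show "x = y" using x y by simp
  qed
  moreover have sub: "?f ` ?A \<subseteq> ?B"
  proof clarify
    fix p w assume p: "p \<in> carrier (alt_group (n + 1))" and "w \<in> R_A n"
    then obtain k where k: "w = a_word n k" "k \<le> Suc n" by (auto simp: R_A_eq)
    obtain e where e: "word_prod a_letter (a_word n k) = (s_gen 1 ^^ e) \<circ> ins_cycle (Suc k) (Suc (n + 1))"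
      using word_prod_a_word[OF n k(2)] .
    have "p \<circ> word_prod a_letter w permutes {1..Suc (n + 1)}"
      unfolding k(1) e comp_assoc[symmetric]
      using p k(2) n by (intro insert_permutes permutes_s_gen_pow) (auto simp: alt_group_carrier)
    moreover have "evenperm (p \<circ> word_prod a_letter w)"
      using evenperm_word_prod[of w] p alt_group_carrier'[OF p] by (simp add: evenperm_comp alt_group_carrier)
    ultimately show "p \<circ> word_prod a_letter w \<in> ?B" by (simp add: alt_group_carrier)
  qed
  moreover have "card (?f ` ?A) = card ?B"
  proof -
    have "card (R_A n) = n + 2"
      unfolding R_A_eq by (subst card_image[OF inj_on_a_word[OF n]]) simp
    then have "2 * card (?f ` ?A) = (n + 2) * (2 * card (carrier (alt_group (n + 1))))"
      unfolding card_image[OF inj] card_cartesian_product by simp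
    also have "\<dots> = fact (Suc n + 1)"
      using alt_group_card_carrier[of "n + 1"] n by simp
    also have "\<dots> = 2 * card ?B" 
      using alt_group_card_carrier[of "Suc n + 1"] by simp
    finally show ?thesis by simp
  qed
  ultimately show "bij_betw ?f ?A ?B"
    using card_subset_eq[OF fin sub] by (simp add: bij_betw_def)
qed

lemma factors_A_eq: "factors_A = A.factors"
  by (simp add: factors_A_def A.factors_def fun_eq_iff)

lemma
  assumes n: "n \<ge> 1" "p \<in> carrier (alt_group (n + 1))" "k \<le> Suc n"
  shows len_A_Suc: "len_A (Suc n) (p \<circ> word_prod a_letter (a_word n k)) = len_A n p + (n - (k - 1))"
    and del_A_Suc: "del_A (Suc n) (p \<circ> word_prod a_letter (a_word n k))
      = del_A n p + (if k - 1 = 0 then 1 else 0)"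
proof -
  have "a_word n k \<in> R_A n" using n by (simp add: R_A_eq)
  then have fac: "factors_A (Suc n) (p \<circ> word_prod a_letter (a_word n k)) = factors_A n p @ [a_word n k]"
    using A.factors_Suc n by (simp add: factors_A_eq)
  show "len_A (Suc n) (p \<circ> word_prod a_letter (a_word n k)) = len_A n p + (n - (k - 1))"
    unfolding len_A_def fac using n by (simp add: length_a_word)
  show "del_A (Suc n) (p \<circ> word_prod a_letter (a_word n k)) = del_A n p + (if k - 1 = 0 then 1 else 0)"
    unfolding del_A_def fac using count_a_word[OF n(1,3)] by simp
qed

lemma A_1: "len_A (Suc 0) id = 0" "del_A (Suc 0) id = 0" "rmaj_A (Suc 0) p = 0"
  by (simp_all add: len_A_def del_A_def factors_A_eq A.factors_Suc_0 rmaj_A_def Des_A_def)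

lemma sum_R_A:
  assumes "n \<ge> 1"
  shows "(\<Sum>w\<in>R_A n. F w) = (\<Sum>k\<le>Suc n. F (a_word n k))"
  unfolding R_A_eq by (subst sum.reindex[OF inj_on_a_word[OF assms]]) simp

text \<open>Both \<open>k = 0\<close> and \<open>k = 1\<close> land in slot 0; this is the source of
  the coefficient 2.\<close>

lemma sum_pred: "(\<Sum>k\<le>Suc n. F (k - 1)) = (\<Sum>j\<le>n. F j) + F 0" for F :: "nat \<Rightarrow> 'a :: comm_monoid_add"
  by (subst sum.atMost_Suc_shift) (simp add: add.commute)

section \<open>Generating function of \<open>len_A\<close> and \<open>del_A\<close>\<close>

lemma sum_len_A:
  fixes q t :: "'a :: comm_semiring_1"
  assumes "n \<ge> 1"
  shows "(\<Sum>w\<in>carrier (alt_group (n + 1)). q ^ len_A n w * t ^ del_A n w)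
    = (\<Prod>j = 1..n - 1. (\<Sum>i<j. q ^ i) + 2 * q ^ j * t)"
proof (rule A.sum_eq_prod)
  fix n p assume n: "1 \<le> n" and p: "p \<in> carrier (alt_group (n + 1))"
  let ?g = "\<lambda>j. q ^ (n - j) * (if j = 0 then t else 1)"
  have "(\<Sum>w\<in>R_A n. q ^ len_A (Suc n) (p \<circ> word_prod a_letter w) * t ^ del_A (Suc n) (p \<circ> word_prod a_letter w))
      = (\<Sum>k\<le>Suc n. (q ^ len_A n p * t ^ del_A n p) * ?g (k - 1))"
    unfolding sum_R_A[OF n]
  proof (intro sum.cong refl)
    fix k assume "k \<in> {..Suc n}"
    then have "k \<le> Suc n" by simp
    from len_A_Suc[OF n p this] del_A_Suc[OF n p this]
    show "q ^ len_A (Suc n) (p \<circ> word_prod a_letter (a_word n k)) * t ^ del_A (Suc n) (p \<circ> word_prod a_letter (a_word n k))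
      = (q ^ len_A n p * t ^ del_A n p) * ?g (k - 1)"
      by (simp only: power_add) (simp add: mult_ac)
  qed
  also have "\<dots> = (q ^ len_A n p * t ^ del_A n p) * ((\<Sum>j\<le>n. ?g j) + ?g 0)"
    unfolding sum_distrib_left[symmetric] sum_pred[of ?g] ..
  also have "(\<Sum>j\<le>n. ?g j) + ?g 0 = (\<Sum>i<n. q ^ i) + 2 * q ^ n * t"
    unfolding sum_power_diff by (simp add: mult_2 algebra_simps)
  finally show "(\<Sum>w\<in>R_A n. q ^ len_A (Suc n) (p \<circ> word_prod a_letter w) * t ^ del_A (Suc n) (p \<circ> word_prod a_letter w))
      = (q ^ len_A n p * t ^ del_A n p) * ((\<Sum>i<n. q ^ i) + 2 * q ^ n * t)" .
qed (use assms in \<open>simp_all only: A_1, simp\<close>)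

subsection \<open>Descents\<close>

definition smaller_left :: "(nat \<Rightarrow> nat) \<Rightarrow> nat \<Rightarrow> nat \<Rightarrow> nat" where
  "smaller_left p k v = card {i \<in> {1..<k}. p i < v}"

text \<open>
  The amount by which \<open>len_A\<close> falls short of its maximum; unlike the factorization it makes sense for
  odd permutations too, and it does not change when the first two entries are exchanged.
\<close>

definition loss :: "nat \<Rightarrow> (nat \<Rightarrow> nat) \<Rightarrow> nat" where
  "loss m p = (\<Sum>k = 1..m. smaller_left p k (p k) - 1)"

lemma smaller_left_le: "smaller_left p k v \<le> k - 1"
proof -
  have "card {i \<in> {1..<k}. p i < v} \<le> card {1..<k}" by (rule card_mono) auto
  then show ?thesis by (simp add: smaller_left_def)
qed

lemma smaller_left_eq_0_iff: "smaller_left p (Suc k) v = 0 \<longleftrightarrow> (\<forall>i\<in>{1..k}. v \<le> p i)"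
proof -
  have "finite {i \<in> {1..<Suc k}. p i < v}" by simp
  then show ?thesis unfolding smaller_left_def card_0_eq by (force simp: not_less)
qed

lemma smaller_left_comp:
  assumes "s permutes {1..<k}"
  shows "smaller_left (p \<circ> s) k v = smaller_left p k v"
proof -
  have "s ` {i \<in> {1..<k}. (p \<circ> s) i < v} = {i \<in> {1..<k}. p i < v}"
  proof (intro equalityI subsetI)
    fix i assume i: "i \<in> {i \<in> {1..<k}. p i < v}"
    then obtain l where l: "l \<in> {1..<k}" "i = s l" using permutes_image[OF assms] by blast
    then show "i \<in> s ` {i \<in> {1..<k}. (p \<circ> s) i < v}" using i by simp
  next
    fix i assume "i \<in> s ` {i \<in> {1..<k}. (p \<circ> s) i < v}"
    then show "i \<in> {i \<in> {1..<k}. p i < v}" using permutes_in_image[OF assms] by auto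
  qed
  then show ?thesis
    unfolding smaller_left_def using card_image[OF permutes_inj_on[OF assms]] by metis
qed

lemma smaller_left_Suc:
  "k \<ge> 1 \<Longrightarrow> smaller_left p (Suc k) v = smaller_left p k v + (if p k < v then 1 else 0)"
proof -
  assume "k \<ge> 1"
  then have "{i \<in> {1..<Suc k}. p i < v} = {i \<in> {1..<k}. p i < v} \<union> (if p k < v then {k} else {})"
    by (auto simp: less_Suc_eq)
  then show ?thesis unfolding smaller_left_def by (simp add: card_Un_disjoint)
qed

lemma smaller_left_cong: "(\<And>i. i < k \<Longrightarrow> p i = p' i) \<Longrightarrow> smaller_left p k v = smaller_left p' k v"
  unfolding smaller_left_def by (rule arg_cong[of _ _ card]) auto

lemma smaller_left_s_gen:
  assumes "1 \<le> i" "k \<noteq> Suc i"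
  shows "smaller_left (p \<circ> s_gen i) k v = smaller_left p k v"
proof (cases "k \<le> i")
  case True
  then show ?thesis by (intro smaller_left_cong) simp
next
  case False
  then have "s_gen i permutes {1..<k}"
    unfolding s_gen_def using assms by (intro permutes_swap_id) auto
  then show ?thesis by (rule smaller_left_comp)
qed

text \<open>At positions 1 and 2 at most one entry lies to the left, so the truncated
  \<open>- 1\<close> makes the term 0. From position 3 on both exchanged entries lie to the left,
  where order is irrelevant.\<close>

lemma loss_s_gen_1: "loss m (p \<circ> s_gen 1) = loss m p"
  unfolding loss_def
proof (intro sum.cong refl)
  fix k assume k: "k \<in> {1..m}"
  show "smaller_left (p \<circ> s_gen 1) k ((p \<circ> s_gen 1) k) - 1 = smaller_left p k (p k) - 1"
  proof (cases "k \<le> 2")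
    case True
    then show ?thesis using smaller_left_le[of "p \<circ> s_gen 1" k "(p \<circ> s_gen 1) k"] smaller_left_le[of p k "p k"]
      by linarith
  next
    case False
    then show ?thesis by (subst smaller_left_s_gen) simp_all
  qed
qed

text \<open>Only the terms at \<open>k\<close> and \<open>Suc k\<close> can change. If
  \<open>p k < p (Suc k)\<close>, the exchange takes the term of the larger entry from y to y - 1
  (truncated), with y = \<open>smaller_left p k (p (Suc k))\<close>, a strict drop unless y = 0; the
  other term stays the same. If \<open>p (Suc k) < p k\<close>, the loss cannot drop.\<close>

lemma loss_s_gen:
  assumes k: "1 \<le> k" "k < m" and neq: "p k \<noteq> p (Suc k)"
  shows "loss m p \<le> loss m (p \<circ> s_gen k) \<longleftrightarrow> p (Suc k) < p k \<or> smaller_left p k (p (Suc k)) = 0"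
proof -
  \<comment> \<open>The count at \<open>Suc k\<close> is rewritten as the count at \<open>k\<close>
    plus one comparison, so both terms use only entries left of \<open>k\<close>, which the exchange
    leaves in place.\<close>
  have split: "loss m f = (\<Sum>l\<in>{1..m} - {k, Suc k}. smaller_left f l (f l) - 1)
      + (smaller_left f k (f k) - 1)
      + (smaller_left f k (f (Suc k)) + (if f k < f (Suc k) then 1 else 0) - 1)" for f
  proof -
    have "{1..m} = ({1..m} - {k, Suc k}) \<union> {k, Suc k}" using k by auto
    then have "loss m f = (\<Sum>l\<in>({1..m} - {k, Suc k}) \<union> {k, Suc k}. smaller_left f l (f l) - 1)"
      unfolding loss_def by simp
    also have "\<dots> = (\<Sum>l\<in>{1..m} - {k, Suc k}. smaller_left f l (f l) - 1)
        + (\<Sum>l\<in>{k, Suc k}. smaller_left f l (f l) - 1)"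
      by (rule sum.union_disjoint) auto
    finally show ?thesis using smaller_left_Suc[OF k(1)] by simp
  qed
  have "(\<Sum>l\<in>{1..m} - {k, Suc k}. smaller_left (p \<circ> s_gen k) l ((p \<circ> s_gen k) l) - 1)
      = (\<Sum>l\<in>{1..m} - {k, Suc k}. smaller_left p l (p l) - 1)"
    using k by (intro sum.cong refl) (subst smaller_left_s_gen, simp_all)
  moreover have "smaller_left (p \<circ> s_gen k) k v = smaller_left p k v" for v
    using k by (intro smaller_left_s_gen) auto
  ultimately show ?thesis
    unfolding split[of p] split[of "p \<circ> s_gen k"] using neq by auto
qed

text \<open>The maximum at position \<open>k\<close> has \<open>k - 1\<close> smaller entries to its
  left. It is smaller than no other entry, so all other counts survive the shift.\<close>

lemma loss_insert:
  assumes p: "p permutes {1..m}" and k: "1 \<le> k" "k \<le> Suc m"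
  shows "loss (Suc m) (p \<circ> ins_cycle k (Suc m)) = loss m p + (k - 2)"
proof -
  let ?P = "p \<circ> ins_cycle k (Suc m)"
  have Pk: "?P k = Suc m" using insert_apply[OF p k k(2)] by simp
  have Ps: "?P (skip k i) = p i" if "i \<in> {1..m}" for i
    using insert_apply_skip[OF p k(2)] that by simp
  have le: "p i < Suc m" if "i \<in> {1..m}" for i using bounds_permutes[OF p that] by simp
  have "{i \<in> {1..<k}. ?P i < Suc m} = {1..<k}"
    using insert_apply[OF p k] le k by (auto simp del: o_apply)
  then have 1: "smaller_left ?P k (?P k) = k - 1"
    unfolding smaller_left_def Pk by simp
  have 2: "smaller_left ?P (skip k i) (?P (skip k i)) = smaller_left p i (p i)" if i: "i \<in> {1..m}" for i
  proof -
    have "{l \<in> {1..<skip k i}. ?P l < ?P (skip k i)} = skip k ` {l \<in> {1..<i}. p l < p i}"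
    proof (intro equalityI subsetI)
      fix l assume l: "l \<in> {l \<in> {1..<skip k i}. ?P l < ?P (skip k i)}"
      then have "l \<in> {1..Suc m}" using i by (auto simp: skip_def split: if_splits)
      moreover have "l \<noteq> k" using l Pk Ps[OF i] le[OF i] by auto
      ultimately obtain b where b: "l = skip k b" "b \<in> {1..m}"
        unfolding atLeastAtMost_Suc_skip[OF k] by blast
      then have "b \<in> {l \<in> {1..<i}. p l < p i}" using l Ps[OF i] Ps[OF b(2)] by (simp del: o_apply)
      then show "l \<in> skip k ` {l \<in> {1..<i}. p l < p i}" using b by blast
    next
      fix l assume "l \<in> skip k ` {l \<in> {1..<i}. p l < p i}"
      then obtain b where b: "l = skip k b" "1 \<le> b" "b < i" "p b < p i" by auto
      moreover have "1 \<le> skip k b" using b by (simp add: skip_def)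
      ultimately show "l \<in> {l \<in> {1..<skip k i}. ?P l < ?P (skip k i)}"
        using Ps[of b] Ps[OF i] i by (simp del: o_apply)
    qed
    then show ?thesis unfolding smaller_left_def by (simp add: card_image[OF inj_skip])
  qed
  have "loss (Suc m) ?P = (smaller_left ?P k (?P k) - 1)
      + (\<Sum>i\<in>skip k ` {1..m}. smaller_left ?P i (?P i) - 1)"
    unfolding loss_def atLeastAtMost_Suc_skip[OF k] by (rule sum.insert) auto
  also have "(\<Sum>i\<in>skip k ` {1..m}. smaller_left ?P i (?P i) - 1) = loss m p"
    unfolding loss_def by (rule sum.reindex_cong[OF inj_skip refl]) (simp only: 2)
  finally show ?thesis using 1 by (simp del: o_apply)
qed

lemma loss_s_gen_pow: "loss m (p \<circ> (s_gen 1 ^^ e)) = loss m p"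
proof (induction e)
  case (Suc e)
  then show ?case
    unfolding funpow_Suc_right comp_assoc[symmetric] loss_s_gen_1 .
qed simp

text \<open>Inserting with index \<open>k\<close> adds \<open>n - (k - 1)\<close> to the length and
  \<open>k - 1\<close> to the loss, hence always \<open>n\<close> to their sum.\<close>

lemma len_A_loss:
  "\<lbrakk>n \<ge> 1; p \<in> carrier (alt_group (n + 1))\<rbrakk> \<Longrightarrow> len_A n p + loss (n + 1) p = (\<Sum>i<n. i)"
proof (induction n arbitrary: p rule: nat_induct_at_least)
  case base
  then have "p = id" using A.G_1 by simp
  moreover have "loss 2 id = 0"
    unfolding loss_def
  proof (intro sum.neutral ballI)
    show "smaller_left id k (id k) - 1 = 0" if "k \<in> {1..2}" for k
      using smaller_left_le[of id k "id k"] that unfolding atLeastAtMost_iff by linarith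
  qed
  ultimately show ?case using A_1(1) by (simp add: numeral_2_eq_2 del: id_apply)
next
  case (Suc n)
  obtain p' w where p': "p' \<in> carrier (alt_group (n + 1))" "w \<in> R_A n" "p = p' \<circ> word_prod a_letter w"
    using A.step_surj[OF Suc.hyps Suc.prems] .
  then obtain k where k: "w = a_word n k" "k \<le> Suc n" by (auto simp: R_A_eq)
  obtain e where e: "word_prod a_letter (a_word n k) = (s_gen 1 ^^ e) \<circ> ins_cycle (Suc k) (Suc (n + 1))"
    using word_prod_a_word[OF Suc.hyps k(2)] .
  have "p = p' \<circ> (s_gen 1 ^^ e) \<circ> ins_cycle (Suc k) (Suc (n + 1))"
    using p'(3) k(1) e by (simp only: comp_assoc)
  then have "loss (Suc (n + 1)) p = loss (n + 1) p' + (k - 1)"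
    using loss_insert[OF permutes_s_gen_pow[of p' n e], of "Suc k"] p' k(2) Suc.hyps loss_s_gen_pow
    by (simp add: alt_group_carrier)
  moreover have "len_A (Suc n) p = len_A n p' + (n - (k - 1))"
    using len_A_Suc[OF Suc.hyps p'(1) k(2)] p'(3) k(1) by simp
  ultimately show ?case using Suc.IH[OF p'(1)] k(2) by simp
qed

section \<open>A combinatorial description of \<open>Des_A\<close> and its behaviour under
  insertion\<close>

definition almost_Des :: "nat \<Rightarrow> (nat \<Rightarrow> nat) \<Rightarrow> nat set" where
  "almost_Des n p = {i \<in> {1..n - 1}. p (i + 2) < p (i + 1) \<or> (\<forall>l\<in>{1..i}. p (i + 2) < p l)}"

lemma almost_Des_subset: "almost_Des n p \<subseteq> {1..n - 1}"
  by (auto simp: almost_Des_def)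

lemma ball_s_gen_1:
  assumes "i \<ge> 2" shows "(\<forall>l\<in>{1..i}. v < p (s_gen 1 l)) \<longleftrightarrow> (\<forall>l\<in>{1..i}. v < p l)"
proof -
  have "s_gen 1 ` {1..i} = {1..i}"
    using permutes_s_gen[of 1 i] assms by (intro permutes_image) auto
  then show ?thesis by (metis (no_types, lifting) image_iff)
qed

text \<open>For \<open>i = 1\<close> the two alternatives are \<open>p 3 < p 2\<close> and
  \<open>p 3 < p 1\<close>, which trade places. For \<open>i \<ge> 2\<close> the range
  \<open>{1..i}\<close> contains both exchanged positions and \<open>i + 1\<close> is neither of
  them.\<close>

lemma almost_Des_s_gen_1: "almost_Des n (p \<circ> s_gen 1) = almost_Des n p"
  unfolding almost_Des_def
proof (intro Collect_cong conj_cong refl)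
  fix i assume i: "i \<in> {1..n - 1}"
  show "(p \<circ> s_gen 1) (i + 2) < (p \<circ> s_gen 1) (i + 1) \<or> (\<forall>l\<in>{1..i}. (p \<circ> s_gen 1) (i + 2) < (p \<circ> s_gen 1) l)
    \<longleftrightarrow> p (i + 2) < p (i + 1) \<or> (\<forall>l\<in>{1..i}. p (i + 2) < p l)"
  proof (cases "i = 1")
    case True
    have "s_gen 1 1 = 2" "s_gen 1 2 = 1" "s_gen 1 3 = 3"
      by (simp_all add: s_gen_def transpose_def)
    then show ?thesis using True by (auto simp: numeral_2_eq_2 numeral_3_eq_3)
  next
    case False
    then have "i \<ge> 2" using i by simp
    then show ?thesis using ball_s_gen_1[of i "p (i + 2)" p] by simp
  qed
qed

text \<open>An insertion step passes through \<open>p \<circ> (s_gen 1 ^^ e)\<close>, which may be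
  odd and so outside the reach of the factorization behind \<open>Des_A\<close>;
  \<open>almost_Des\<close> can be followed through it.\<close>

lemma almost_Des_s_gen_pow: "almost_Des n (p \<circ> (s_gen 1 ^^ e)) = almost_Des n p"
proof (induction e)
  case (Suc e)
  then show ?case
    unfolding funpow_Suc_right comp_assoc[symmetric] almost_Des_s_gen_1 .
qed simp

text \<open>By \<open>len_A_loss\<close>, comparing lengths is comparing losses in reverse. Since
  the loss ignores s_1, multiplying by a_i acts on it as an adjacent exchange at position
  \<open>i + 1\<close>, and \<open>loss_s_gen\<close> applies.\<close>

lemma Des_A_eq:
  assumes n: "n \<ge> 1" and p: "p \<in> carrier (alt_group (n + 1))"
  shows "Des_A n p = almost_Des n p"
proof -
  have perm: "p permutes {1..n + 1}" using p by (simp add: alt_group_carrier)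
  have "len_A n p \<ge> len_A n (p \<circ> a_gen i)
      \<longleftrightarrow> p (i + 2) < p (i + 1) \<or> (\<forall>l\<in>{1..i}. p (i + 2) < p l)" if i: "i \<in> {1..n - 1}" for i
  proof -
    let ?p = "p \<circ> s_gen 1"
    have p_a: "p \<circ> a_gen i = ?p \<circ> s_gen (Suc i)" by (simp add: a_gen_def comp_assoc del: o_apply)
    have perm': "?p permutes {1..n + 1}"
      using permutes_s_gen_pow[OF perm n, of 1] by simp
    have "p \<circ> a_gen i permutes {1..n + 1}"
      unfolding p_a using i by (intro permutes_compose[OF permutes_s_gen perm']) auto
    moreover have "evenperm (p \<circ> a_gen i)"
      using evenperm_a_letter[of "(i, True)"] p alt_group_carrier'[OF p]
      by (simp add: a_letter_def evenperm_comp alt_group_carrier)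
    ultimately have "p \<circ> a_gen i \<in> carrier (alt_group (n + 1))" by (simp add: alt_group_carrier)
    then have "len_A n p \<ge> len_A n (p \<circ> a_gen i) \<longleftrightarrow> loss (n + 1) ?p \<le> loss (n + 1) (?p \<circ> s_gen (Suc i))"
      using len_A_loss[OF n p] len_A_loss[OF n, of "p \<circ> a_gen i"] unfolding p_a loss_s_gen_1 by linarith
    also have "\<dots> \<longleftrightarrow> ?p (Suc (Suc i)) < ?p (Suc i) \<or> smaller_left ?p (Suc i) (?p (Suc (Suc i))) = 0"
      using i injD[OF permutes_inj[OF perm'], of "Suc i" "Suc (Suc i)"] by (intro loss_s_gen) auto
    also have "smaller_left ?p (Suc i) (?p (Suc (Suc i))) = 0 \<longleftrightarrow> (\<forall>l\<in>{1..i}. ?p (Suc (Suc i)) < ?p l)"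
    proof -
      have "?p l \<noteq> ?p (Suc (Suc i))" if "l \<in> {1..i}" for l
        using injD[OF permutes_inj[OF perm'], of l "Suc (Suc i)"] that by auto
      then show ?thesis
        unfolding smaller_left_eq_0_iff by (metis le_less)
    qed
    also have "?p (Suc (Suc i)) < ?p (Suc i) \<or> (\<forall>l\<in>{1..i}. ?p (Suc (Suc i)) < ?p l)
        \<longleftrightarrow> i \<in> almost_Des n ?p"
      using i by (simp add: almost_Des_def)
    also have "\<dots> \<longleftrightarrow> p (i + 2) < p (i + 1) \<or> (\<forall>l\<in>{1..i}. p (i + 2) < p l)"
      unfolding almost_Des_s_gen_1 using i by (simp add: almost_Des_def)
    finally show ?thesis .
  qed
  then show ?thesis unfolding Des_A_def almost_Des_def by blast
qed

text \<open>Every old entry is smaller than the new maximum, so the maximum never spoils the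
  condition of lying below all earlier entries. Hence the rule \<open>ins_des\<close> holds again,
  with slot \<open>k - 1\<close>.\<close>

lemma almost_Des_insert:
  assumes p: "p permutes {1..n + 1}" and k: "k \<le> Suc n" and n: "n \<ge> 1"
  shows "almost_Des (Suc n) (p \<circ> ins_cycle (Suc k) (Suc (n + 1))) = ins_des n (k - 1) (almost_Des n p)"
proof (rule Set.set_eqI)
  fix i
  let ?P = "p \<circ> ins_cycle (Suc k) (Suc (n + 1))"
  have P: "?P x = (if x \<le> k then p x else if x = Suc k then n + 2 else p (x - 1))" if "x \<le> n + 2" for x
    using insert_apply[OF p, of "Suc k" x] k that by auto
  have le: "p x < n + 2" if "x \<in> {1..n + 1}" for x using bounds_permutes[OF p that] by simp
  have D: "i \<in> almost_Des (Suc n) ?P \<longleftrightarrow>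
      i \<in> {1..n} \<and> (?P (i + 2) < ?P (i + 1) \<or> (\<forall>l\<in>{1..i}. ?P (i + 2) < ?P l))"
    by (simp add: almost_Des_def)
  have D': "i \<in> almost_Des n p \<longleftrightarrow>
      1 \<le> i \<and> i < n \<and> (p (i + 2) < p (i + 1) \<or> (\<forall>l\<in>{1..i}. p (i + 2) < p l))" for i
    by (auto simp: almost_Des_def)
  show "i \<in> almost_Des (Suc n) ?P \<longleftrightarrow> i \<in> ins_des n (k - 1) (almost_Des n p)"
  proof (cases "i \<in> {1..n}")
    case False
    then show ?thesis using k n unfolding D mem_ins_des D' by auto
  next
    case i: True
    consider "Suc i < k" | "Suc i = k" | "i = k" | "k < i" by linarith
    then show ?thesis
    proof cases
      case 1
      then have "?P x = p x" if "x \<le> i + 2" for x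
        using P[of x] that k by simp
      then have "i \<in> almost_Des (Suc n) ?P \<longleftrightarrow> i \<in> almost_Des n p"
        unfolding D D' using i k 1 by (simp del: o_apply)
      then show ?thesis unfolding mem_ins_des using 1 by auto
    next
      case 2
      \<comment> \<open>The maximum is the entry at \<open>i + 2\<close>, so neither alternative can
        hold; in \<open>ins_des\<close> this is the discarded position
        \<open>i = k - 1\<close>.\<close>
      have "?P (i + 2) = n + 2" using 2 P[of "i + 2"] k by simp
      moreover have "?P (i + 1) < n + 2" "?P i < n + 2"
        using 2 i k P[of "i + 1"] P[of i] le[of "i + 1"] le[of i] by simp_all
      ultimately have "\<not> ?P (i + 2) < ?P (i + 1)" "\<not> ?P (i + 2) < ?P i" by simp_all
      then have "\<not> (?P (i + 2) < ?P (i + 1) \<or> (\<forall>l\<in>{1..i}. ?P (i + 2) < ?P l))"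
        using i by auto
      then show ?thesis using 2 unfolding D mem_ins_des by auto
    next
      case 3
      then have "?P (i + 2) < ?P (i + 1)" using i k P[of "i + 2"] P[of "i + 1"] le[of "i + 1"] by simp
      then show ?thesis using 3 i unfolding D mem_ins_des by auto
    next
      case 4
      have P2: "?P (i + 2) = p (i + 1)" using P[of "i + 2"] i 4 by simp
      have "{1..i} = insert (Suc k) (skip (Suc k) ` {1..i - 1})"
        using atLeastAtMost_Suc_skip[of "Suc k" "i - 1"] i 4 by simp
      moreover have "?P (skip (Suc k) l) = p l" if "l \<in> {1..i - 1}" for l
        using k i that by (intro insert_apply_skip[OF p]) auto
      moreover have "?P (Suc k) = n + 2" "p (i + 1) < n + 2"
        using P[of "Suc k"] k le[of "i + 1"] i by auto
      ultimately have all: "(\<forall>l\<in>{1..i}. p (i + 1) < ?P l) \<longleftrightarrow> (\<forall>l\<in>{1..i - 1}. p (i + 1) < p l)"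
        by (simp del: o_apply)
      show ?thesis
      \<comment> \<open>Here \<open>k = 0\<close>: the maximum comes first and is the only entry in
        the range, so the second alternative holds. This is the new descent \<open>Suc 0\<close> of
        slot 0, which for \<open>k = 1\<close> arises from the first alternative.\<close>
      proof (cases "i = 1")
        case True
        then show ?thesis using 4 n unfolding D mem_ins_des P2 all by simp
      next
        case False
        have P1: "?P (i + 1) = p i" using P[of "i + 1"] i 4 by simp
        have "i \<in> almost_Des (Suc n) ?P \<longleftrightarrow> i - 1 \<in> almost_Des n p"
          unfolding D D' all P1 P2 using i False by auto
        moreover have "i \<in> ins_des n (k - 1) (almost_Des n p) \<longleftrightarrow> i - 1 \<in> almost_Des n p"
          unfolding mem_ins_des using 4 i False by auto
        ultimately show ?thesis by simp
      qed
    qed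
  qed
qed

lemma rmaj_A_Suc:
  assumes n: "n \<ge> 1" and p: "p \<in> carrier (alt_group (n + 1))" and k: "k \<le> Suc n"
  shows "rmaj_A (Suc n) (p \<circ> word_prod a_letter (a_word n k)) = rmaj_A n p + ins_incr n (Des_A n p) (k - 1)"
proof -
  let ?P = "p \<circ> word_prod a_letter (a_word n k)"
  obtain e where e: "word_prod a_letter (a_word n k) = (s_gen 1 ^^ e) \<circ> ins_cycle (Suc k) (Suc (n + 1))"
    using word_prod_a_word[OF n k] .
  have perm: "p permutes {1..n + 1}" using p by (simp add: alt_group_carrier)
  have "?P \<in> carrier (alt_group (Suc n + 1))"
    using A.step_in[OF n p] k by (simp add: R_A_eq del: o_apply)
  then have "Des_A (Suc n) ?P = almost_Des (Suc n) ?P"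
    by (intro Des_A_eq) simp_all
  also have "\<dots> = ins_des n (k - 1) (almost_Des n p)"
    unfolding e comp_assoc[symmetric] almost_Des_insert[OF permutes_s_gen_pow[OF perm n] k n]
      almost_Des_s_gen_pow ..
  finally have "Des_A (Suc n) ?P = ins_des n (k - 1) (Des_A n p)"
    unfolding Des_A_eq[OF n p] .
  then show ?thesis
    unfolding rmaj_A_def using sum_ins_des[OF almost_Des_subset, of "k - 1" n p] k
    by (simp add: Des_A_eq[OF n p])
qed

section \<open>Generating function of \<open>rmaj_A\<close> and \<open>del_A\<close>\<close>

lemma sum_rmaj_A:
  fixes q t :: "'a :: comm_semiring_1"
  assumes "n \<ge> 1"
  shows "(\<Sum>w\<in>carrier (alt_group (n + 1)). q ^ rmaj_A n w * t ^ del_A n w)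
    = (\<Prod>j = 1..n - 1. (\<Sum>i<j. q ^ i) + 2 * q ^ j * t)"
proof (rule A.sum_eq_prod)
  fix n p assume n: "1 \<le> n" and p: "p \<in> carrier (alt_group (n + 1))"
  have D: "Des_A n p \<subseteq> {1..n - 1}" by (auto simp: Des_A_def)
  let ?g = "\<lambda>j. q ^ ins_incr n (Des_A n p) j * (if j = 0 then t else 1)"
  have "(\<Sum>w\<in>R_A n. q ^ rmaj_A (Suc n) (p \<circ> word_prod a_letter w) * t ^ del_A (Suc n) (p \<circ> word_prod a_letter w))
      = (\<Sum>k\<le>Suc n. (q ^ rmaj_A n p * t ^ del_A n p) * ?g (k - 1))"
    unfolding sum_R_A[OF n]
  proof (intro sum.cong refl)
    fix k assume "k \<in> {..Suc n}"
    then have "k \<le> Suc n" by simp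
    from rmaj_A_Suc[OF n p this] del_A_Suc[OF n p this]
    show "q ^ rmaj_A (Suc n) (p \<circ> word_prod a_letter (a_word n k)) * t ^ del_A (Suc n) (p \<circ> word_prod a_letter (a_word n k))
      = (q ^ rmaj_A n p * t ^ del_A n p) * ?g (k - 1)"
      by (simp only: power_add) (simp add: mult_ac)
  qed
  also have "\<dots> = (q ^ rmaj_A n p * t ^ del_A n p) * ((\<Sum>j\<le>n. ?g j) + ?g 0)"
    unfolding sum_distrib_left[symmetric] sum_pred[of ?g] ..
  also have "(\<Sum>j\<le>n. ?g j) + ?g 0 = (\<Sum>i<n. q ^ i) + 2 * q ^ n * t"
    unfolding sum_ins_incr[OF D] ins_incr_0[OF D] by (simp add: mult_2 algebra_simps)
  finally show "(\<Sum>w\<in>R_A n. q ^ rmaj_A (Suc n) (p \<circ> word_prod a_letter w) * t ^ del_A (Suc n) (p \<circ> word_prod a_letter w))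
      = (q ^ rmaj_A n p * t ^ del_A n p) * ((\<Sum>i<n. q ^ i) + 2 * q ^ n * t)" .
qed (use assms in \<open>simp_all only: A_1, simp\<close>)

theorem theorem6p1:
  fixes n :: nat and q t :: "'a :: comm_ring_1"
  assumes "n \<ge> 1"
  shows
    "((\<Sum>\<sigma>\<in>carrier (sym_group n). q ^ len_S n \<sigma> * t ^ del_S n \<sigma>)
        = (\<Sum>\<sigma>\<in>carrier (sym_group n). q ^ rmaj_S n \<sigma> * t ^ del_S n \<sigma>)
      \<and> (\<Sum>\<sigma>\<in>carrier (sym_group n). q ^ rmaj_S n \<sigma> * t ^ del_S n \<sigma>)
        = (\<Prod>j = 1..n - 1. (\<Sum>i<j. q ^ i) + q ^ j * t))
   \<and> ((\<Sum>w\<in>carrier (alt_group (n + 1)). q ^ len_A n w * t ^ del_A n w)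
        = (\<Sum>w\<in>carrier (alt_group (n + 1)). q ^ rmaj_A n w * t ^ del_A n w)
      \<and> (\<Sum>w\<in>carrier (alt_group (n + 1)). q ^ rmaj_A n w * t ^ del_A n w)
        = (\<Prod>j = 1..n - 1. (\<Sum>i<j. q ^ i) + 2 * q ^ j * t))"
  using sum_len_S[OF assms, of q t] sum_rmaj_S[OF assms, of q t]
    sum_len_A[OF assms, of q t] sum_rmaj_A[OF assms, of q t]
  by simp

end
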